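(* Let $L$ be a $d$-generator generalized Heisenberg Lie algebra of rank $\frac{1}{2}d(d-1)-1$ or $\frac{1}{2}d(d-1)-2$. Then $L$ is capable.
   Context: Lie algebras are over a field. Write $H^2=[H,H]$. A Lie algebra $H$ is called a generalized Heisenberg Lie algebra of rank $n$ if $H^2=Z(H)$ and $\dim H^2=n$. It is $d$-generator if a minimal generating set has $d$ elements, i.e. $\dim H/H^2=d$. A Lie algebra $L$ is called capable if $L\cong E/Z(E)$ for some Lie algebra $E$. *)

theory Defs
  imports Complex_Main
    "Jordan_Normal_Form.Missing_VectorSpace"
    "HOL-Algebra.QuotRing"
begin

section \<open>Lie algebras over a field\<close>

text \<open>The record extends \<^typ>\<open>('k, 'v) module\<close>, so the ring fields \<open>mult\<close> and \<open>one\<close>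
  are present, but no axiom and no notion below refers to them.\<close>

record ('k, 'v) lie_alg = "('k, 'v) module" +
  bracket :: "'v \<Rightarrow> 'v \<Rightarrow> 'v"  ("\<lbrakk>_, _\<rbrakk>\<index>")

locale lie_algebra = vectorspace K L
  for K :: "('k, 'm) ring_scheme" and L :: "('k, 'v, 'n) lie_alg_scheme" (structure) +
  assumes bracket_closed [simp, intro]:
      "\<lbrakk> x \<in> carrier L; y \<in> carrier L \<rbrakk> \<Longrightarrow> \<lbrakk>x, y\<rbrakk> \<in> carrier L"
    and bracket_add_left:
      "\<lbrakk> x \<in> carrier L; y \<in> carrier L; z \<in> carrier L \<rbrakk> \<Longrightarrow>
        \<lbrakk>x \<oplus> y, z\<rbrakk> = \<lbrakk>x, z\<rbrakk> \<oplus> \<lbrakk>y, z\<rbrakk>"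
    and bracket_add_right:
      "\<lbrakk> x \<in> carrier L; y \<in> carrier L; z \<in> carrier L \<rbrakk> \<Longrightarrow>
        \<lbrakk>x, y \<oplus> z\<rbrakk> = \<lbrakk>x, y\<rbrakk> \<oplus> \<lbrakk>x, z\<rbrakk>"
    and bracket_smult_left:
      "\<lbrakk> c \<in> carrier K; x \<in> carrier L; y \<in> carrier L \<rbrakk> \<Longrightarrow> \<lbrakk>c \<odot> x, y\<rbrakk> = c \<odot> \<lbrakk>x, y\<rbrakk>"
    and bracket_smult_right:
      "\<lbrakk> c \<in> carrier K; x \<in> carrier L; y \<in> carrier L \<rbrakk> \<Longrightarrow> \<lbrakk>x, c \<odot> y\<rbrakk> = c \<odot> \<lbrakk>x, y\<rbrakk>"
    and bracket_self: "x \<in> carrier L \<Longrightarrow> \<lbrakk>x, x\<rbrakk> = \<zero>"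
    and jacobi:
      "\<lbrakk> x \<in> carrier L; y \<in> carrier L; z \<in> carrier L \<rbrakk> \<Longrightarrow>
        \<lbrakk>x, \<lbrakk>y, z\<rbrakk>\<rbrakk> \<oplus> \<lbrakk>y, \<lbrakk>z, x\<rbrakk>\<rbrakk> \<oplus> \<lbrakk>z, \<lbrakk>x, y\<rbrakk>\<rbrakk> = \<zero>"

definition lie_center :: "('k, 'v, 'n) lie_alg_scheme \<Rightarrow> 'v set" where
  "lie_center L = {z \<in> carrier L. \<forall>x \<in> carrier L. \<lbrakk>z, x\<rbrakk>\<^bsub>L\<^esub> = \<zero>\<^bsub>L\<^esub>}"

definition lie_derived ::
    "('k, 'm) ring_scheme \<Rightarrow> ('k, 'v, 'n) lie_alg_scheme \<Rightarrow> 'v set" where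
  "lie_derived K L = module.span K L {\<lbrakk>x, y\<rbrakk>\<^bsub>L\<^esub> | x y. x \<in> carrier L \<and> y \<in> carrier L}"

text \<open>The quotient of \<open>L\<close> by an ideal \<open>I\<close>, on the cosets of \<open>I\<close>. Scalar multiplication and
  bracket are set-valued lifts, as for the product in \<^const>\<open>FactRing\<close>; they are the usual
  operations on cosets when \<open>I\<close> is an ideal. The entries of \<open>mult\<close> and \<open>one\<close> are placeholders.\<close>

definition lie_quotient ::
    "('k, 'v, 'n) lie_alg_scheme \<Rightarrow> 'v set \<Rightarrow> ('k, 'v set) lie_alg" where
  "lie_quotient L I =
    \<lparr> carrier = A_RCOSETS L I, mult = (\<lambda>A B. I), one = I,
      zero = I, add = set_add L,
      smult = (\<lambda>c A. \<Union>a\<in>A. I +>\<^bsub>L\<^esub> (c \<odot>\<^bsub>L\<^esub> a)),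
      bracket = (\<lambda>A B. \<Union>a\<in>A. \<Union>b\<in>B. I +>\<^bsub>L\<^esub> \<lbrakk>a, b\<rbrakk>\<^bsub>L\<^esub>) \<rparr>"

definition lie_hom ::
    "('k, 'm) ring_scheme \<Rightarrow> ('k, 'v, 'n) lie_alg_scheme \<Rightarrow> ('k, 'w, 'p) lie_alg_scheme
      \<Rightarrow> ('v \<Rightarrow> 'w) set" where
  "lie_hom K L M = {f \<in> module_hom K L M.
    \<forall>x \<in> carrier L. \<forall>y \<in> carrier L. f \<lbrakk>x, y\<rbrakk>\<^bsub>L\<^esub> = \<lbrakk>f x, f y\<rbrakk>\<^bsub>M\<^esub>}"

definition lie_isomorphic ::
    "('k, 'm) ring_scheme \<Rightarrow> ('k, 'v, 'n) lie_alg_scheme \<Rightarrow> ('k, 'w, 'p) lie_alg_scheme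
      \<Rightarrow> bool" where
  "lie_isomorphic K L M \<longleftrightarrow> (\<exists>f \<in> lie_hom K L M. bij_betw f (carrier L) (carrier M))"

text \<open>Since \<^const>\<open>vectorspace.dim\<close> is a natural number also for infinite-dimensional spaces,
  finite dimension is required explicitly.\<close>

definition generalized_heisenberg ::
    "('k, 'm) ring_scheme \<Rightarrow> ('k, 'v, 'n) lie_alg_scheme \<Rightarrow> nat \<Rightarrow> bool" where
  "generalized_heisenberg K L n \<longleftrightarrow> lie_algebra K L
    \<and> lie_derived K L = lie_center L
    \<and> vectorspace.fin_dim K (L\<lparr>carrier := lie_derived K L\<rparr>)
    \<and> vectorspace.dim K (L\<lparr>carrier := lie_derived K L\<rparr>) = n"

text \<open>For nilpotent \<open>L\<close> the dimension of \<open>L/L\<^sup>2\<close> is the size of a minimal generating set.\<close>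

definition d_generator ::
    "('k, 'm) ring_scheme \<Rightarrow> ('k, 'v, 'n) lie_alg_scheme \<Rightarrow> nat \<Rightarrow> bool" where
  "d_generator K L d \<longleftrightarrow> lie_algebra K L
    \<and> vectorspace.fin_dim K (lie_quotient L (lie_derived K L))
    \<and> vectorspace.dim K (lie_quotient L (lie_derived K L)) = d"

section \<open>Quotients by ideals\<close>

context lie_algebra
begin

lemma bracket_zero [simp]:
  assumes "x \<in> carrier L"
  shows "\<lbrakk>x, \<zero>\<rbrakk> = \<zero>" "\<lbrakk>\<zero>, x\<rbrakk> = \<zero>"
proof -
  have "\<lbrakk>x, \<zero>\<^bsub>K\<^esub> \<odot> \<zero>\<rbrakk> = \<zero>\<^bsub>K\<^esub> \<odot> \<lbrakk>x, \<zero>\<rbrakk>"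
    using assms by (intro bracket_smult_right) auto
  then show "\<lbrakk>x, \<zero>\<rbrakk> = \<zero>" using assms by simp
  have "\<lbrakk>\<zero>\<^bsub>K\<^esub> \<odot> \<zero>, x\<rbrakk> = \<zero>\<^bsub>K\<^esub> \<odot> \<lbrakk>\<zero>, x\<rbrakk>"
    using assms by (intro bracket_smult_left) auto
  then show "\<lbrakk>\<zero>, x\<rbrakk> = \<zero>" using assms by simp
qed

lemma bracket_swap_zero:
  assumes "x \<in> carrier L" "y \<in> carrier L" "\<lbrakk>x, y\<rbrakk> = \<zero>"
  shows "\<lbrakk>y, x\<rbrakk> = \<zero>"
proof -
  have "\<zero> = \<lbrakk>x \<oplus> y, x \<oplus> y\<rbrakk>" using assms bracket_self by simp
  also have "\<dots> = (\<lbrakk>x, x\<rbrakk> \<oplus> \<lbrakk>x, y\<rbrakk>) \<oplus> (\<lbrakk>y, x\<rbrakk> \<oplus> \<lbrakk>y, y\<rbrakk>)"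
    using assms by (simp add: bracket_add_left bracket_add_right M.a_assoc)
  also have "\<dots> = \<lbrakk>y, x\<rbrakk>" using assms by (simp add: bracket_self)
  finally show ?thesis by simp
qed

end

locale lie_ideal = lie_algebra +
  fixes I
  assumes ideal_submodule: "submodule K I L"
    and ideal_right: "\<lbrakk> x \<in> carrier L; i \<in> I \<rbrakk> \<Longrightarrow> \<lbrakk>x, i\<rbrakk> \<in> I"
    and ideal_left: "\<lbrakk> i \<in> I; x \<in> carrier L \<rbrakk> \<Longrightarrow> \<lbrakk>i, x\<rbrakk> \<in> I"
begin

lemma ideal_carrier: "i \<in> I \<Longrightarrow> i \<in> carrier L"
  using ideal_submodule unfolding submodule_def by auto

lemma ideal_zero: "\<zero> \<in> I"
  using ideal_submodule unfolding submodule_def by auto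

lemma ideal_add: "i \<in> I \<Longrightarrow> j \<in> I \<Longrightarrow> i \<oplus> j \<in> I"
  using ideal_submodule unfolding submodule_def by auto

lemma ideal_smult: "c \<in> carrier K \<Longrightarrow> i \<in> I \<Longrightarrow> c \<odot> i \<in> I"
  using ideal_submodule unfolding submodule_def by auto

lemma ideal_subgroup: "abelian_subgroup I L"
proof -
  have "subgroup I (add_monoid L)"
  proof (rule group.subgroupI)
    show "group (add_monoid L)" by (rule M.a_group)
    fix a assume "a \<in> I"
    then have "(\<ominus>\<^bsub>K\<^esub> \<one>\<^bsub>K\<^esub>) \<odot> a \<in> I" by (intro ideal_smult) auto
    then have "\<ominus> a \<in> I" using \<open>a \<in> I\<close> ideal_carrier by (simp add: smult_l_minus)
    then show "inv\<^bsub>add_monoid L\<^esub> a \<in> I" by (simp add: a_inv_def)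
  next
    show "I \<noteq> {}" using ideal_zero by blast
  qed (simp_all add: ideal_add ideal_carrier subsetI)
  then show ?thesis
    by (rule abelian_subgroupI3[OF additive_subgroupI M.abelian_group_axioms])
qed

sublocale S: abelian_subgroup I L
  by (rule ideal_subgroup)

lemma quotient_carrier: "carrier (lie_quotient L I) = (\<lambda>x. I +> x) ` carrier L"
  by (auto simp: lie_quotient_def A_RCOSETS_def')

lemma coset_eq_iff:
  assumes "x \<in> carrier L" "y \<in> carrier L"
  shows "I +> x = I +> y \<longleftrightarrow> x \<oplus> \<ominus> y \<in> I"
proof
  assume "I +> x = I +> y"
  then have "x \<in> I +> y" using S.a_rcos_self[OF assms(1)] by simp
  then show "x \<oplus> \<ominus> y \<in> I" using S.a_rcos_module_imp[OF assms(2)] assms by auto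
next
  assume "x \<oplus> \<ominus> y \<in> I"
  then have "x \<in> I +> y" using S.a_rcos_module_rev[OF assms(2)] assms by auto
  then show "I +> x = I +> y" using S.a_repr_independence'[OF _ assms(2), of x] by simp
qed

lemma coset_mem: "x \<in> carrier L \<Longrightarrow> a \<in> I +> x \<longleftrightarrow> (\<exists>i\<in>I. a = i \<oplus> x)"
  by (auto simp: a_r_coset_def')

lemma coset_shift: "i \<in> I \<Longrightarrow> x \<in> carrier L \<Longrightarrow> I +> (i \<oplus> x) = I +> x"
  by (subst coset_eq_iff) (auto simp: ideal_carrier M.a_assoc M.r_neg)

lemma quotient_zero: "\<zero>\<^bsub>lie_quotient L I\<^esub> = I +> \<zero>"
  using S.a_subset by (simp add: lie_quotient_def M.a_coset_add_zero)

lemma quotient_add: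
  "x \<in> carrier L \<Longrightarrow> y \<in> carrier L \<Longrightarrow>
    (I +> x) \<oplus>\<^bsub>lie_quotient L I\<^esub> (I +> y) = I +> (x \<oplus> y)"
  by (simp add: lie_quotient_def S.a_rcos_sum)

lemma quotient_smult:
  assumes "c \<in> carrier K" "x \<in> carrier L"
  shows "c \<odot>\<^bsub>lie_quotient L I\<^esub> (I +> x) = I +> (c \<odot> x)"
proof -
  have "I +> (c \<odot> a) = I +> (c \<odot> x)" if "a \<in> I +> x" for a
    using that assms
    by (auto simp: coset_mem smult_r_distr ideal_carrier coset_shift ideal_smult)
  then have "(\<Union>a \<in> I +> x. I +> (c \<odot> a)) = (\<Union>a \<in> I +> x. I +> (c \<odot> x))"
    by (intro SUP_cong refl)
  also have "\<dots> = I +> (c \<odot> x)"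
    using S.a_rcos_self[OF assms(2)] by blast
  finally show ?thesis by (simp add: lie_quotient_def)
qed

lemma quotient_bracket:
  assumes "x \<in> carrier L" "y \<in> carrier L"
  shows "\<lbrakk>I +> x, I +> y\<rbrakk>\<^bsub>lie_quotient L I\<^esub> = I +> \<lbrakk>x, y\<rbrakk>"
proof -
  have "I +> \<lbrakk>a, b\<rbrakk> = I +> \<lbrakk>x, y\<rbrakk>" if ab: "a \<in> I +> x" "b \<in> I +> y" for a b
  proof -
    obtain i j where ij: "i \<in> I" "a = i \<oplus> x" "j \<in> I" "b = j \<oplus> y"
      using ab assms by (auto simp: coset_mem)
    have "\<lbrakk>a, b\<rbrakk> = \<lbrakk>i, b\<rbrakk> \<oplus> (\<lbrakk>x, j\<rbrakk> \<oplus> \<lbrakk>x, y\<rbrakk>)"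
    proof -
      have "b \<in> carrier L" using ij assms by (simp add: ideal_carrier)
      then have "\<lbrakk>a, b\<rbrakk> = \<lbrakk>i, b\<rbrakk> \<oplus> \<lbrakk>x, b\<rbrakk>"
        unfolding ij(2) using ij assms by (intro bracket_add_left) (simp_all add: ideal_carrier)
      also have "\<lbrakk>x, b\<rbrakk> = \<lbrakk>x, j\<rbrakk> \<oplus> \<lbrakk>x, y\<rbrakk>"
        unfolding ij(4) using ij assms by (intro bracket_add_right) (simp_all add: ideal_carrier)
      finally show ?thesis .
    qed
    then show ?thesis
      using ij assms by (simp add: coset_shift ideal_left ideal_right ideal_carrier)
  qed
  then have "(\<Union>a \<in> I +> x. \<Union>b \<in> I +> y. I +> \<lbrakk>a, b\<rbrakk>) =
      (\<Union>a \<in> I +> x. \<Union>b \<in> I +> y. I +> \<lbrakk>x, y\<rbrakk>)"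
    by (intro SUP_cong refl)
  also have "\<dots> = I +> \<lbrakk>x, y\<rbrakk>"
    using S.a_rcos_self[OF assms(1)] S.a_rcos_self[OF assms(2)] by blast
  finally show ?thesis by (simp add: lie_quotient_def)
qed

lemmas quotient_simps = quotient_zero quotient_add quotient_smult quotient_bracket

lemma quotient_lie_algebra: "lie_algebra K (lie_quotient L I)"
proof -
  have vs: "vectorspace K (lie_quotient L I)"
  proof (rule vs_criteria)
    show "field K" by (rule field_axioms)
    show "\<forall>v\<in>carrier (lie_quotient L I). \<exists>w\<in>carrier (lie_quotient L I).
        v \<oplus>\<^bsub>lie_quotient L I\<^esub> w = \<zero>\<^bsub>lie_quotient L I\<^esub>"
    proof
      fix v assume "v \<in> carrier (lie_quotient L I)"
      then obtain x where "x \<in> carrier L" "v = I +> x" by (auto simp: quotient_carrier)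
      then show "\<exists>w\<in>carrier (lie_quotient L I). v \<oplus>\<^bsub>lie_quotient L I\<^esub> w = \<zero>\<^bsub>lie_quotient L I\<^esub>"
        by (intro bexI[of _ "I +> (\<ominus> x)"])
           (auto simp: quotient_carrier quotient_simps M.r_neg)
    qed
  qed (auto simp: quotient_carrier quotient_simps M.a_ac smult_l_distr smult_r_distr smult_assoc1)
  show ?thesis
    by (intro lie_algebra.intro vs lie_algebra_axioms.intro)
       (auto simp: quotient_carrier quotient_simps bracket_add_left bracket_add_right
          bracket_smult_left bracket_smult_right bracket_self jacobi)
qed

end

lemma (in lie_algebra) center_lie_ideal: "lie_ideal K L (lie_center L)"
proof (intro lie_ideal.intro lie_ideal_axioms.intro)
  show "lie_algebra K L" ..
  show "submodule K (lie_center L) L"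
    by unfold_locales
       (auto simp: lie_center_def bracket_add_left bracket_smult_left)
qed (auto simp: lie_center_def dest: bracket_swap_zero)

lemma (in lie_algebra) derived_lie_ideal: "lie_ideal K L (lie_derived K L)"
proof -
  let ?B = "{\<lbrakk>x, y\<rbrakk> | x y. x \<in> carrier L \<and> y \<in> carrier L}"
  have B: "?B \<subseteq> carrier L" by (blast intro: bracket_closed)
  have sub: "submodule K (span ?B) L" by (rule span_is_submodule[OF B])
  have own: "?B \<subseteq> span ?B" by (rule in_own_span[OF B])
  have car: "span ?B \<subseteq> carrier L" by (rule submodule.subset[OF sub])
  show ?thesis
  proof (intro lie_ideal.intro lie_ideal_axioms.intro)
    show "lie_algebra K L" ..
    show "submodule K (lie_derived K L) L" using sub by (simp add: lie_derived_def)
  next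
    fix x i assume "x \<in> carrier L" "i \<in> lie_derived K L"
    then have "x \<in> carrier L" "i \<in> carrier L"
      unfolding lie_derived_def using car by (blast dest: subsetD)+
    then have "\<lbrakk>x, i\<rbrakk> \<in> ?B" "\<lbrakk>i, x\<rbrakk> \<in> ?B" by blast+
    then show "\<lbrakk>x, i\<rbrakk> \<in> lie_derived K L" "\<lbrakk>i, x\<rbrakk> \<in> lie_derived K L"
      unfolding lie_derived_def using own by (blast dest: subsetD)+
  qed
qed

section \<open>Capability\<close>

text \<open>HOL cannot quantify over the carrier type of \<open>E\<close> inside a formula. It suffices to look at
  carriers consisting of formal Lie expressions over \<open>L\<close>: if \<open>L \<cong> E/Z(E)\<close>, then lifts of the
  elements of \<open>L\<close> generate a subalgebra \<open>E'\<close> of \<open>E\<close> with \<open>L \<cong> E'/Z(E')\<close>, and each element of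
  \<open>E'\<close> is the value of a formal expression. Lemma \<open>capableI\<close> below proves that the definition
  covers every \<open>E\<close>, over any type.\<close>

datatype ('k, 'v) lie_term =
    Gen 'v
  | Zero
  | Add "('k, 'v) lie_term" "('k, 'v) lie_term"
  | Smult 'k "('k, 'v) lie_term"
  | Bracket "('k, 'v) lie_term" "('k, 'v) lie_term"

definition capable ::
    "('k, 'm) ring_scheme \<Rightarrow> ('k, 'v, 'n) lie_alg_scheme \<Rightarrow> bool" where
  "capable K L \<longleftrightarrow> lie_algebra K L
    \<and> (\<exists>E :: ('k, ('k, 'v) lie_term) lie_alg.
        lie_algebra K E \<and> lie_isomorphic K L (lie_quotient E (lie_center E)))"

text \<open>\<open>L \<cong> E/Z(E)\<close> says that \<open>L\<close> is a homomorphic image of \<open>E\<close> with kernel \<open>Z(E)\<close>.\<close>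

lemma isomorphic_central_quotient_iff:
  assumes "lie_algebra K L" "lie_algebra K E"
  shows "lie_isomorphic K L (lie_quotient E (lie_center E)) \<longleftrightarrow>
    (\<exists>p \<in> lie_hom K E L. p ` carrier E = carrier L
      \<and> (\<forall>x \<in> carrier E. p x = \<zero>\<^bsub>L\<^esub> \<longleftrightarrow> x \<in> lie_center E))"
    (is "?l \<longleftrightarrow> ?r")
proof -
  interpret L: lie_algebra K L by fact
  interpret E: lie_algebra K E by fact
  let ?Z = "lie_center E"
  let ?Q = "lie_quotient E ?Z"
  interpret Z: lie_ideal K E ?Z by (rule E.center_lie_ideal)
  let ?c = "\<lambda>x. ?Z +>\<^bsub>E\<^esub> x"
  show ?thesis
  proof
    assume ?l
    then obtain f where f: "f \<in> lie_hom K L ?Q" and b: "bij_betw f (carrier L) (carrier ?Q)"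
      unfolding lie_isomorphic_def by auto
    define g where "g = inv_into (carrier L) f"
    have g: "g A \<in> carrier L" "f (g A) = A" if "A \<in> carrier ?Q" for A
      using that bij_betw_imp_surj_on[OF b] unfolding g_def
      by (simp_all add: inv_into_into f_inv_into_f)
    have eqI: "u = v" if "f u = f v" "u \<in> carrier L" "v \<in> carrier L" for u v
      using b that unfolding bij_betw_def inj_on_def by blast
    have f_add: "f (u \<oplus>\<^bsub>L\<^esub> v) = f u \<oplus>\<^bsub>?Q\<^esub> f v"
      and f_br: "f \<lbrakk>u, v\<rbrakk>\<^bsub>L\<^esub> = \<lbrakk>f u, f v\<rbrakk>\<^bsub>?Q\<^esub>"
      if "u \<in> carrier L" "v \<in> carrier L" for u v
      using f that unfolding lie_hom_def module_hom_def by auto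
    have f_sm: "f (c \<odot>\<^bsub>L\<^esub> u) = c \<odot>\<^bsub>?Q\<^esub> f u" if "c \<in> carrier K" "u \<in> carrier L" for u c
      using f that unfolding lie_hom_def module_hom_def by auto
    have cQ: "?c x \<in> carrier ?Q" if "x \<in> carrier E" for x
      using that by (auto simp: Z.quotient_carrier)
    have f0: "f \<zero>\<^bsub>L\<^esub> = ?c \<zero>\<^bsub>E\<^esub>"
    proof -
      interpret Q: lie_algebra K ?Q by (rule Z.quotient_lie_algebra)
      have "f (\<zero>\<^bsub>K\<^esub> \<odot>\<^bsub>L\<^esub> \<zero>\<^bsub>L\<^esub>) = \<zero>\<^bsub>K\<^esub> \<odot>\<^bsub>?Q\<^esub> f \<zero>\<^bsub>L\<^esub>"
        by (rule f_sm) auto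
      moreover have "f \<zero>\<^bsub>L\<^esub> \<in> carrier ?Q"
        using b bij_betwE by blast
      ultimately show ?thesis by (simp add: Z.quotient_zero)
    qed
    have hom: "(\<lambda>x. g (?c x)) \<in> lie_hom K E L"
      unfolding lie_hom_def module_hom_def
      by (auto intro!: eqI g(1) simp: g cQ f_add f_br f_sm Z.quotient_simps)
    have surj: "(\<lambda>x. g (?c x)) ` carrier E = carrier L"
    proof (intro equalityI subsetI)
      fix y assume y: "y \<in> carrier L"
      then have "f y \<in> carrier ?Q" using b bij_betwE by blast
      then obtain x where "x \<in> carrier E" "f y = ?c x" by (auto simp: Z.quotient_carrier)
      then show "y \<in> (\<lambda>x. g (?c x)) ` carrier E"
        using y by (intro image_eqI[of _ _ x] eqI) (auto simp: g cQ)
    qed (use g cQ in auto)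
    have ker: "g (?c x) = \<zero>\<^bsub>L\<^esub> \<longleftrightarrow> x \<in> ?Z" if x: "x \<in> carrier E" for x
    proof -
      have "g (?c x) = \<zero>\<^bsub>L\<^esub> \<longleftrightarrow> f (g (?c x)) = f \<zero>\<^bsub>L\<^esub>"
        using eqI[of "g (?c x)" "\<zero>\<^bsub>L\<^esub>"] g(1)[OF cQ[OF x]] by auto
      also have "\<dots> \<longleftrightarrow> ?c x = ?c \<zero>\<^bsub>E\<^esub>" using x by (simp add: g cQ f0)
      also have "\<dots> \<longleftrightarrow> x \<in> ?Z" using x by (simp add: Z.coset_eq_iff E.M.add.inv_one[simplified] a_inv_def)
      finally show ?thesis .
    qed
    show ?r using hom surj ker by blast
  next
    assume ?r
    then obtain p where p: "p \<in> lie_hom K E L" and s: "p ` carrier E = carrier L"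
      and k: "\<And>x. x \<in> carrier E \<Longrightarrow> p x = \<zero>\<^bsub>L\<^esub> \<longleftrightarrow> x \<in> ?Z" by blast
    define q where "q = inv_into (carrier E) p"
    have q: "q y \<in> carrier E" "p (q y) = y" if "y \<in> carrier L" for y
      using that s unfolding q_def by (auto intro: inv_into_into f_inv_into_f)
    have pc: "p x \<in> carrier L" if "x \<in> carrier E" for x using s that by blast
    have p_add: "p (u \<oplus>\<^bsub>E\<^esub> v) = p u \<oplus>\<^bsub>L\<^esub> p v"
      and p_br: "p \<lbrakk>u, v\<rbrakk>\<^bsub>E\<^esub> = \<lbrakk>p u, p v\<rbrakk>\<^bsub>L\<^esub>"
      if "u \<in> carrier E" "v \<in> carrier E" for u v
      using p that unfolding lie_hom_def module_hom_def by auto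
    have p_sm: "p (c \<odot>\<^bsub>E\<^esub> u) = c \<odot>\<^bsub>L\<^esub> p u" if "c \<in> carrier K" "u \<in> carrier E" for u c
      using p that unfolding lie_hom_def module_hom_def by auto
    have p_minus: "p (\<ominus>\<^bsub>E\<^esub> u) = \<ominus>\<^bsub>L\<^esub> p u" if "u \<in> carrier E" for u
      using p_sm[OF _ that, of "\<ominus>\<^bsub>K\<^esub> \<one>\<^bsub>K\<^esub>"] that pc
      by (simp add: E.smult_l_minus L.smult_l_minus)
    have c_eq: "?c u = ?c v \<longleftrightarrow> p u = p v" if "u \<in> carrier E" "v \<in> carrier E" for u v
    proof -
      have "?c u = ?c v \<longleftrightarrow> p u \<oplus>\<^bsub>L\<^esub> \<ominus>\<^bsub>L\<^esub> p v = \<zero>\<^bsub>L\<^esub>"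
        using that by (simp add: Z.coset_eq_iff k[symmetric] p_add p_minus)
      also have "\<dots> \<longleftrightarrow> p u = p v"
        using that pc by (metis L.M.add.inv_closed L.M.minus_equality L.M.minus_minus L.M.r_neg)
      finally show ?thesis .
    qed
    define f where "f y = ?c (q y)" for y
    have "f \<in> lie_hom K L ?Q"
      unfolding lie_hom_def module_hom_def f_def
      by (auto simp: Z.quotient_carrier q Z.quotient_simps c_eq p_add p_br p_sm)
    moreover have "bij_betw f (carrier L) (carrier ?Q)"
    proof (rule bij_betwI')
      fix u v assume "u \<in> carrier L" "v \<in> carrier L"
      then show "(f u = f v) = (u = v)" by (simp add: f_def c_eq q)
    next
      fix u assume "u \<in> carrier L"
      then show "f u \<in> carrier ?Q" by (auto simp: f_def q Z.quotient_carrier)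
    next
      fix A assume "A \<in> carrier ?Q"
      then obtain x where x: "x \<in> carrier E" "A = ?c x" by (auto simp: Z.quotient_carrier)
      then show "\<exists>u\<in>carrier L. A = f u"
        by (intro bexI[of _ "p x"]) (auto simp: f_def c_eq q pc)
    qed
    ultimately show ?l unfolding lie_isomorphic_def by blast
  qed
qed

primrec term_value ::
    "('k, 'm) ring_scheme \<Rightarrow> ('k, 'e, 'n) lie_alg_scheme \<Rightarrow> ('v \<Rightarrow> 'e)
      \<Rightarrow> ('k, 'v) lie_term \<Rightarrow> 'e" where
  "term_value K E g (Gen v) = g v"
| "term_value K E g Zero = \<zero>\<^bsub>E\<^esub>"
| "term_value K E g (Add s t) = term_value K E g s \<oplus>\<^bsub>E\<^esub> term_value K E g t"
| "term_value K E g (Smult c t) =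
    (if c \<in> carrier K then c \<odot>\<^bsub>E\<^esub> term_value K E g t else \<zero>\<^bsub>E\<^esub>)"
| "term_value K E g (Bracket s t) = \<lbrakk>term_value K E g s, term_value K E g t\<rbrakk>\<^bsub>E\<^esub>"

lemma capableI:
  fixes K :: "('k, 'm) ring_scheme"
    and L :: "('k, 'v, 'n) lie_alg_scheme"
    and E :: "('k, 'e, 'p) lie_alg_scheme"
  assumes L: "lie_algebra K L" and E: "lie_algebra K E"
    and iso: "lie_isomorphic K L (lie_quotient E (lie_center E))"
  shows "capable K L"
proof -
  interpret L: lie_algebra K L by fact
  interpret E: lie_algebra K E by fact
  obtain p where p: "p \<in> lie_hom K E L" and s: "p ` carrier E = carrier L"
      and k: "\<And>x. x \<in> carrier E \<Longrightarrow> p x = \<zero>\<^bsub>L\<^esub> \<longleftrightarrow> x \<in> lie_center E"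
    using iso isomorphic_central_quotient_iff[OF L E] by blast
  have pc: "p x \<in> carrier L" if "x \<in> carrier E" for x using s that by blast
  have p_add: "p (u \<oplus>\<^bsub>E\<^esub> v) = p u \<oplus>\<^bsub>L\<^esub> p v"
    and p_br: "p \<lbrakk>u, v\<rbrakk>\<^bsub>E\<^esub> = \<lbrakk>p u, p v\<rbrakk>\<^bsub>L\<^esub>"
    if "u \<in> carrier E" "v \<in> carrier E" for u v
    using p that unfolding lie_hom_def module_hom_def by auto
  have p_sm: "p (c \<odot>\<^bsub>E\<^esub> u) = c \<odot>\<^bsub>L\<^esub> p u" if "c \<in> carrier K" "u \<in> carrier E" for u c
    using p that unfolding lie_hom_def module_hom_def by auto
  have p_minus: "p (\<ominus>\<^bsub>E\<^esub> u) = \<ominus>\<^bsub>L\<^esub> p u" if "u \<in> carrier E" for u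
    using p_sm[OF _ that, of "\<ominus>\<^bsub>K\<^esub> \<one>\<^bsub>K\<^esub>"] that pc
    by (simp add: E.smult_l_minus L.smult_l_minus)
  define g where "g y = (if y \<in> carrier L then inv_into (carrier E) p y else \<zero>\<^bsub>E\<^esub>)" for y
  have g: "g y \<in> carrier E" for y
    unfolding g_def using s by (auto intro: inv_into_into)
  have pg: "p (g y) = y" if "y \<in> carrier L" for y
    unfolding g_def using that s by (auto intro: f_inv_into_f)
  define ev :: "('k, 'v) lie_term \<Rightarrow> 'e" where "ev = term_value K E g"
  have evc: "ev t \<in> carrier E" for t
    unfolding ev_def by (induction t) (auto simp: g)
  define r where "r = inv_into UNIV ev"
  define S where "S = range ev"
  have ev_S: "ev t \<in> S" for t by (simp add: S_def)
  have ev_r: "ev (r x) = x" if "x \<in> S" for x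
    using that unfolding S_def r_def by (rule f_inv_into_f)
  have S_carrier: "x \<in> carrier E" if "x \<in> S" for x
    using that evc by (auto simp: S_def)
  have S_gen: "g y \<in> S" for y
    unfolding S_def by (rule range_eqI[of _ _ "Gen y"]) (simp add: ev_def)
  have S_zero: "\<zero>\<^bsub>E\<^esub> \<in> S"
    unfolding S_def by (rule range_eqI[of _ _ Zero]) (simp add: ev_def)
  have S_add: "x \<oplus>\<^bsub>E\<^esub> y \<in> S" and S_bracket: "\<lbrakk>x, y\<rbrakk>\<^bsub>E\<^esub> \<in> S" if xy: "x \<in> S" "y \<in> S" for x y
  proof -
    obtain t u where "x = ev t" "y = ev u" using xy by (auto simp: S_def)
    then have "x \<oplus>\<^bsub>E\<^esub> y = ev (Add t u)" "\<lbrakk>x, y\<rbrakk>\<^bsub>E\<^esub> = ev (Bracket t u)" by (simp_all add: ev_def)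
    then show "x \<oplus>\<^bsub>E\<^esub> y \<in> S" "\<lbrakk>x, y\<rbrakk>\<^bsub>E\<^esub> \<in> S" by (simp_all add: ev_S)
  qed
  have S_smult: "c \<odot>\<^bsub>E\<^esub> x \<in> S" if cx: "c \<in> carrier K" "x \<in> S" for c x
  proof -
    obtain t where "x = ev t" using cx by (auto simp: S_def)
    then have "c \<odot>\<^bsub>E\<^esub> x = ev (Smult c t)" using cx by (simp add: ev_def)
    then show ?thesis by (simp add: ev_S)
  qed
  note S_simps = S_gen S_zero S_add S_bracket S_smult ev_S ev_r evc
  define F :: "('k, ('k, 'v) lie_term) lie_alg" where
    "F = \<lparr> carrier = r ` S, mult = (\<lambda>t u. t), one = r \<zero>\<^bsub>E\<^esub>,
      zero = r \<zero>\<^bsub>E\<^esub>, add = (\<lambda>t u. r (ev t \<oplus>\<^bsub>E\<^esub> ev u)),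
      smult = (\<lambda>c t. r (c \<odot>\<^bsub>E\<^esub> ev t)), bracket = (\<lambda>t u. r \<lbrakk>ev t, ev u\<rbrakk>\<^bsub>E\<^esub>) \<rparr>"
  have F_zero: "\<zero>\<^bsub>F\<^esub> = r \<zero>\<^bsub>E\<^esub>"
    and F_add: "t \<oplus>\<^bsub>F\<^esub> u = r (ev t \<oplus>\<^bsub>E\<^esub> ev u)"
    and F_smult: "c \<odot>\<^bsub>F\<^esub> t = r (c \<odot>\<^bsub>E\<^esub> ev t)"
    and F_bracket: "\<lbrakk>t, u\<rbrakk>\<^bsub>F\<^esub> = r \<lbrakk>ev t, ev u\<rbrakk>\<^bsub>E\<^esub>" for c t u
    by (simp_all add: F_def)
  note F_simps = F_zero F_add F_smult F_bracket
  have rF: "r x \<in> carrier F" if "x \<in> S" for x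
    using that by (simp add: F_def)
  have rev: "r (ev t) = t" if "t \<in> carrier F" for t
    using that by (auto simp: F_def ev_r)
  have neg: "\<exists>u\<in>carrier F. t \<oplus>\<^bsub>F\<^esub> u = \<zero>\<^bsub>F\<^esub>" for t
  proof (intro bexI)
    let ?u = "(\<ominus>\<^bsub>K\<^esub> \<one>\<^bsub>K\<^esub>) \<odot>\<^bsub>E\<^esub> ev t"
    have u: "?u \<in> S" by (intro S_smult ev_S) auto
    then show "r ?u \<in> carrier F" by (rule rF)
    have "ev t \<oplus>\<^bsub>E\<^esub> ?u = \<zero>\<^bsub>E\<^esub>" by (simp add: evc E.smult_l_minus E.M.r_neg)
    then show "t \<oplus>\<^bsub>F\<^esub> r ?u = \<zero>\<^bsub>F\<^esub>" by (simp only: F_simps ev_r[OF u])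
  qed
  have vsF: "vectorspace K F"
  proof (rule vs_criteria)
    show "field K" by (rule L.field_axioms)
  qed (use neg in \<open>auto intro!: rF simp: F_simps S_simps rev E.M.a_ac
        E.smult_l_distr E.smult_r_distr E.smult_assoc1\<close>)
  have lieF: "lie_algebra K F"
    by (intro lie_algebra.intro vsF lie_algebra_axioms.intro)
       (auto intro!: rF simp: F_simps S_simps E.bracket_add_left E.bracket_add_right
          E.bracket_smult_left E.bracket_smult_right E.bracket_self E.jacobi)
  define pF where "pF t = p (ev t)" for t
  have GenF: "r (g y) \<in> carrier F" "ev (r (g y)) = g y" for y
    by (simp_all add: rF S_simps)
  have hom: "pF \<in> lie_hom K F L"
    unfolding lie_hom_def module_hom_def pF_def
    by (auto simp: F_simps S_simps pc p_add p_br p_sm)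
  have surj: "pF ` carrier F = carrier L"
  proof (intro equalityI subsetI)
    fix y assume "y \<in> carrier L"
    then show "y \<in> pF ` carrier F"
      by (intro image_eqI[of _ _ "r (g y)"]) (auto simp: pF_def GenF pg)
  qed (auto simp: pF_def pc evc)
  have ker: "pF t = \<zero>\<^bsub>L\<^esub> \<longleftrightarrow> t \<in> lie_center F" if t: "t \<in> carrier F" for t
  proof
    assume "pF t = \<zero>\<^bsub>L\<^esub>"
    then have "ev t \<in> lie_center E" by (simp add: pF_def k evc)
    then show "t \<in> lie_center F" using t by (simp add: lie_center_def F_simps evc)
  next
    assume tc: "t \<in> lie_center F"
    have "\<lbrakk>ev t, x\<rbrakk>\<^bsub>E\<^esub> = \<zero>\<^bsub>E\<^esub>" if x: "x \<in> carrier E" for x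
    proof -
      define u where "u = g (p x)"
      have u: "u \<in> carrier E" "p u = p x" by (simp_all add: u_def g pg pc x)
      have "\<lbrakk>t, r u\<rbrakk>\<^bsub>F\<^esub> = \<zero>\<^bsub>F\<^esub>" using tc GenF by (simp add: lie_center_def u_def)
      then have "ev (r \<lbrakk>ev t, ev (r u)\<rbrakk>\<^bsub>E\<^esub>) = ev (r \<zero>\<^bsub>E\<^esub>)" by (simp add: F_simps)
      then have 1: "\<lbrakk>ev t, u\<rbrakk>\<^bsub>E\<^esub> = \<zero>\<^bsub>E\<^esub>" by (simp add: S_simps u_def)
      define w where "w = x \<oplus>\<^bsub>E\<^esub> \<ominus>\<^bsub>E\<^esub> u"
      have w: "w \<in> carrier E" using x u by (simp add: w_def)
      have xw: "x = w \<oplus>\<^bsub>E\<^esub> u" using x u by (simp add: w_def E.M.a_assoc E.M.l_neg)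
      have "p w = \<zero>\<^bsub>L\<^esub>"
        using x u pc by (simp add: w_def p_add p_minus L.M.r_neg)
      then have "w \<in> lie_center E" using w by (simp add: k)
      then have "\<lbrakk>w, ev t\<rbrakk>\<^bsub>E\<^esub> = \<zero>\<^bsub>E\<^esub>" using evc[of t] unfolding lie_center_def by blast
      then have 2: "\<lbrakk>ev t, w\<rbrakk>\<^bsub>E\<^esub> = \<zero>\<^bsub>E\<^esub>"
        by (rule E.bracket_swap_zero[OF w evc])
      have "\<lbrakk>ev t, x\<rbrakk>\<^bsub>E\<^esub> = \<lbrakk>ev t, w\<rbrakk>\<^bsub>E\<^esub> \<oplus>\<^bsub>E\<^esub> \<lbrakk>ev t, u\<rbrakk>\<^bsub>E\<^esub>"
        unfolding xw by (rule E.bracket_add_right[OF evc w u(1)])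
      then show ?thesis by (simp add: 1 2)
    qed
    then have "ev t \<in> lie_center E" by (simp add: lie_center_def evc)
    then show "pF t = \<zero>\<^bsub>L\<^esub>" by (simp add: pF_def k evc)
  qed
  have "lie_isomorphic K L (lie_quotient F (lie_center F))"
    unfolding isomorphic_central_quotient_iff[OF L lieF]
    by (intro bexI[OF _ hom] conjI surj ballI ker)
  with L lieF show ?thesis
    unfolding capable_def by (intro conjI exI[of _ F])
qed

end

theory Submission
  imports Defs
begin

text \<open>
  Let \<open>Z = Z(L) = [L, L]\<close> and \<open>V = L/Z\<close>, with basis \<open>e 0, ..., e (d - 1)\<close>. A central extension of
  \<open>L\<close> by a 2-cocycle \<open>\<phi>\<close> has \<open>L\<close> as its central quotient as soon as no nonzero \<open>z\<close> in \<open>Z\<close> satisfies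
  \<open>\<phi> z x = 0\<close> for all \<open>x\<close> (\<open>capable_by_cocycle\<close>). The natural cocycle to try pairs \<open>z\<close> in \<open>Z\<close> and
  \<open>x\<close> in \<open>V\<close> to the class of \<open>z \<otimes> x\<close> in \<open>(Z \<otimes> V)/J\<close>. Here \<open>J\<close> is the image of the third exterior power
  of \<open>V\<close> that the Jacobi identity forces to vanish: an alternating array \<open>t\<close> gives the sum over
  \<open>k\<close> and over \<open>i < j\<close> of \<open>t i j k [e i, e j] \<otimes> e k\<close>. What remains is to show that \<open>z\<close> is zero if
  all \<open>z \<otimes> e k\<close> lie in \<open>J\<close>.

  The rank hypothesis says that the \<open>d (d - 1)/2\<close> brackets \<open>[e i, e j]\<close>, which span \<open>Z\<close>, satisfy at
  most two independent linear relations; so the bivectors that map to multiples of \<open>z\<close> form a space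
  \<open>W\<close> of dimension at most 3. If \<open>z \<otimes> e l\<close> comes from the array \<open>t\<close>, all contractions of \<open>t\<close> lie
  in \<open>W\<close>. But a nonzero trivector has at least three independent contractions, so a nonzero \<open>t\<close>
  fills \<open>W\<close> with them (\<open>relation_vanishes\<close>), and then every other array with contractions in \<open>W\<close> is a
  multiple of \<open>t\<close>. So \<open>z \<otimes> e 0\<close> and \<open>z \<otimes> e 1\<close> would be proportional, which is impossible unless
  \<open>z = 0\<close> (\<open>delta_sequences_zero\<close>). The case \<open>d < 2\<close> does not occur, because the rank is not negative.
\<close>

section \<open>Central extensions from cocycles\<close>

text \<open>The extension is \<open>L \<times> M\<close> with bracket \<open>[(x, a), (y, b)] = ([x, y], \<phi> x y)\<close>; the cocycle identity is
  its Jacobi identity. A pair \<open>(x, a)\<close> is central exactly when \<open>x\<close> is central in \<open>L\<close> and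
  \<open>\<phi> x\<close> vanishes, so the last hypothesis says that the kernel of the projection to \<open>L\<close> is the
  whole center.\<close>

lemma capable_by_cocycle:
  fixes K :: "('k, 'm) ring_scheme"
    and L :: "('k, 'v, 'n) lie_alg_scheme"
    and M :: "('k, 'w, 'p) module_scheme"
    and \<phi> :: "'v \<Rightarrow> 'v \<Rightarrow> 'w"
  assumes L: "lie_algebra K L" and M: "vectorspace K M"
    and closed: "\<And>x y. \<lbrakk>x \<in> carrier L; y \<in> carrier L\<rbrakk> \<Longrightarrow> \<phi> x y \<in> carrier M"
    and add_left: "\<And>x y z. \<lbrakk>x \<in> carrier L; y \<in> carrier L; z \<in> carrier L\<rbrakk> \<Longrightarrow>
      \<phi> (x \<oplus>\<^bsub>L\<^esub> y) z = \<phi> x z \<oplus>\<^bsub>M\<^esub> \<phi> y z"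
    and add_right: "\<And>x y z. \<lbrakk>x \<in> carrier L; y \<in> carrier L; z \<in> carrier L\<rbrakk> \<Longrightarrow>
      \<phi> x (y \<oplus>\<^bsub>L\<^esub> z) = \<phi> x y \<oplus>\<^bsub>M\<^esub> \<phi> x z"
    and smult_left: "\<And>r x y. \<lbrakk>r \<in> carrier K; x \<in> carrier L; y \<in> carrier L\<rbrakk> \<Longrightarrow>
      \<phi> (r \<odot>\<^bsub>L\<^esub> x) y = r \<odot>\<^bsub>M\<^esub> \<phi> x y"
    and smult_right: "\<And>r x y. \<lbrakk>r \<in> carrier K; x \<in> carrier L; y \<in> carrier L\<rbrakk> \<Longrightarrow>
      \<phi> x (r \<odot>\<^bsub>L\<^esub> y) = r \<odot>\<^bsub>M\<^esub> \<phi> x y"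
    and alternating: "\<And>x. x \<in> carrier L \<Longrightarrow> \<phi> x x = \<zero>\<^bsub>M\<^esub>"
    and cocycle: "\<And>x y z. \<lbrakk>x \<in> carrier L; y \<in> carrier L; z \<in> carrier L\<rbrakk> \<Longrightarrow>
      \<phi> x \<lbrakk>y, z\<rbrakk>\<^bsub>L\<^esub> \<oplus>\<^bsub>M\<^esub> \<phi> y \<lbrakk>z, x\<rbrakk>\<^bsub>L\<^esub> \<oplus>\<^bsub>M\<^esub> \<phi> z \<lbrakk>x, y\<rbrakk>\<^bsub>L\<^esub> = \<zero>\<^bsub>M\<^esub>"
    and separates: "\<And>x. \<lbrakk>x \<in> lie_center L; \<And>y. y \<in> carrier L \<Longrightarrow> \<phi> x y = \<zero>\<^bsub>M\<^esub>\<rbrakk> \<Longrightarrow> x = \<zero>\<^bsub>L\<^esub>"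
  shows "capable K L"
proof -
  interpret L: lie_algebra K L by fact
  interpret M: vectorspace K M by fact
  define E :: "('k, 'v \<times> 'w) lie_alg" where
    "E = \<lparr> carrier = carrier L \<times> carrier M, mult = (\<lambda>u v. u), one = (\<zero>\<^bsub>L\<^esub>, \<zero>\<^bsub>M\<^esub>),
      zero = (\<zero>\<^bsub>L\<^esub>, \<zero>\<^bsub>M\<^esub>), add = (\<lambda>u v. (fst u \<oplus>\<^bsub>L\<^esub> fst v, snd u \<oplus>\<^bsub>M\<^esub> snd v)),
      smult = (\<lambda>r u. (r \<odot>\<^bsub>L\<^esub> fst u, r \<odot>\<^bsub>M\<^esub> snd u)),
      bracket = (\<lambda>u v. (\<lbrakk>fst u, fst v\<rbrakk>\<^bsub>L\<^esub>, \<phi> (fst u) (fst v))) \<rparr>"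
  have carrier_E: "carrier E = carrier L \<times> carrier M" by (simp add: E_def)
  have zero_E: "\<zero>\<^bsub>E\<^esub> = (\<zero>\<^bsub>L\<^esub>, \<zero>\<^bsub>M\<^esub>)"
    and add_E: "\<And>u v. u \<oplus>\<^bsub>E\<^esub> v = (fst u \<oplus>\<^bsub>L\<^esub> fst v, snd u \<oplus>\<^bsub>M\<^esub> snd v)"
    and smult_E: "\<And>r u. r \<odot>\<^bsub>E\<^esub> u = (r \<odot>\<^bsub>L\<^esub> fst u, r \<odot>\<^bsub>M\<^esub> snd u)"
    and bracket_E: "\<And>u v. \<lbrakk>u, v\<rbrakk>\<^bsub>E\<^esub> = (\<lbrakk>fst u, fst v\<rbrakk>\<^bsub>L\<^esub>, \<phi> (fst u) (fst v))"
    by (simp_all add: E_def)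
  note E_simps = carrier_E zero_E add_E smult_E bracket_E
  have vsE: "vectorspace K E"
  proof (rule vs_criteria)
    show "field K" by (rule L.field_axioms)
    show "\<forall>u\<in>carrier E. \<exists>v\<in>carrier E. u \<oplus>\<^bsub>E\<^esub> v = \<zero>\<^bsub>E\<^esub>"
    proof
      fix u assume "u \<in> carrier E"
      then show "\<exists>v\<in>carrier E. u \<oplus>\<^bsub>E\<^esub> v = \<zero>\<^bsub>E\<^esub>"
        by (intro bexI[of _ "(\<ominus>\<^bsub>L\<^esub> fst u, \<ominus>\<^bsub>M\<^esub> snd u)"])
           (auto simp: E_simps L.M.r_neg M.M.r_neg)
    qed
  qed (auto simp: E_simps L.M.a_ac M.M.a_ac L.smult_l_distr L.smult_r_distr L.smult_assoc1
        M.smult_l_distr M.smult_r_distr M.smult_assoc1)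
  have lieE: "lie_algebra K E"
    by (intro lie_algebra.intro vsE lie_algebra_axioms.intro)
       (auto simp: E_simps closed add_left add_right smult_left smult_right alternating cocycle
          L.bracket_add_left L.bracket_add_right L.bracket_smult_left L.bracket_smult_right
          L.bracket_self L.jacobi)
  have "fst \<in> lie_hom K E L"
    by (auto simp: lie_hom_def module_hom_def E_simps)
  moreover have "fst ` carrier E = carrier L"
    by (auto simp: carrier_E intro!: image_eqI[of _ fst "(_, \<zero>\<^bsub>M\<^esub>)"])
  moreover have "fst u = \<zero>\<^bsub>L\<^esub> \<longleftrightarrow> u \<in> lie_center E" if u: "u \<in> carrier E" for u
  proof
    assume "fst u = \<zero>\<^bsub>L\<^esub>"
    moreover have "\<phi> \<zero>\<^bsub>L\<^esub> y = \<zero>\<^bsub>M\<^esub>" if "y \<in> carrier L" for y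
      using smult_left[of "\<zero>\<^bsub>K\<^esub>" "\<zero>\<^bsub>L\<^esub>" y] that closed by simp
    ultimately show "u \<in> lie_center E"
      using u by (auto simp: lie_center_def E_simps)
  next
    assume "u \<in> lie_center E"
    then have "\<lbrakk>fst u, y\<rbrakk>\<^bsub>L\<^esub> = \<zero>\<^bsub>L\<^esub> \<and> \<phi> (fst u) y = \<zero>\<^bsub>M\<^esub>" if "y \<in> carrier L" for y
      using that by (fastforce simp: lie_center_def E_simps dest: bspec[of _ _ "(y, \<zero>\<^bsub>M\<^esub>)"])
    then show "fst u = \<zero>\<^bsub>L\<^esub>"
      using u by (intro separates) (auto simp: lie_center_def carrier_E)
  qed
  ultimately have "lie_isomorphic K L (lie_quotient E (lie_center E))"
    unfolding isomorphic_central_quotient_iff[OF L lieE] by blast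
  with L lieE show ?thesis by (rule capableI)
qed

section \<open>Linear algebra\<close>

lemma (in vectorspace) coordinates_wrt_basis:
  assumes fin: "finite B" and B: "basis B"
  obtains co where "\<And>v. v \<in> carrier V \<Longrightarrow> co v \<in> B \<rightarrow> carrier K"
    and "\<And>v. v \<in> carrier V \<Longrightarrow> lincomb (co v) B = v"
    and "\<And>v w b. \<lbrakk>v \<in> carrier V; w \<in> carrier V; b \<in> B\<rbrakk> \<Longrightarrow> co (v \<oplus>\<^bsub>V\<^esub> w) b = co v b \<oplus>\<^bsub>K\<^esub> co w b"
    and "\<And>r v b. \<lbrakk>r \<in> carrier K; v \<in> carrier V; b \<in> B\<rbrakk> \<Longrightarrow> co (r \<odot>\<^bsub>V\<^esub> v) b = r \<otimes>\<^bsub>K\<^esub> co v b"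
    and "\<And>b c. \<lbrakk>b \<in> B; c \<in> B\<rbrakk> \<Longrightarrow> co b c = (if b = c then \<one>\<^bsub>K\<^esub> else \<zero>\<^bsub>K\<^esub>)"
proof -
  have BV: "B \<subseteq> carrier V" using B by (simp add: basis_def)
  have ex1: "\<exists>!a. a \<in> B \<rightarrow>\<^sub>E carrier K \<and> lincomb a B = v" if "v \<in> carrier V" for v
    using basis_criterion[OF fin BV] B that by blast
  define co where "co v = (THE a. a \<in> B \<rightarrow>\<^sub>E carrier K \<and> lincomb a B = v)" for v
  have co: "co v \<in> B \<rightarrow>\<^sub>E carrier K" "lincomb (co v) B = v" if "v \<in> carrier V" for v
    using theI'[OF ex1[OF that]] by (simp_all add: co_def)
  have co_PiE: "co v \<in> B \<rightarrow> carrier K" if "v \<in> carrier V" for v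
    using co(1)[OF that] by (auto simp: PiE_def)
  have coI: "co v b = f b"
    if that: "v \<in> carrier V" "b \<in> B" "f \<in> B \<rightarrow> carrier K" "lincomb f B = v" for v f b
  proof -
    have "restrict f B \<in> B \<rightarrow>\<^sub>E carrier K" using that by auto
    moreover have "lincomb (restrict f B) B = v"
      using that BV by (subst lincomb_cong[where B = B and b = f]) auto
    ultimately have "co v = restrict f B"
      using ex1[OF that(1)] co[OF that(1)] by blast
    then show ?thesis using that by simp
  qed
  show thesis
  proof (rule that[of co])
    show "co (v \<oplus>\<^bsub>V\<^esub> w) b = co v b \<oplus>\<^bsub>K\<^esub> co w b"
      if "v \<in> carrier V" "w \<in> carrier V" "b \<in> B" for v w b
      using that co_PiE fin BV
      by (intro coI[of _ _ "\<lambda>b. co v b \<oplus>\<^bsub>K\<^esub> co w b"])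
         (auto simp: lincomb_sum co intro!: R.a_closed)
    show "co (r \<odot>\<^bsub>V\<^esub> v) b = r \<otimes>\<^bsub>K\<^esub> co v b"
      if "r \<in> carrier K" "v \<in> carrier V" "b \<in> B" for r v b
      using that co_PiE fin BV
      by (intro coI[of _ _ "\<lambda>b. r \<otimes>\<^bsub>K\<^esub> co v b"])
         (auto simp: lincomb_smult co intro!: R.m_closed)
    show "co b c = (if b = c then \<one>\<^bsub>K\<^esub> else \<zero>\<^bsub>K\<^esub>)" if "b \<in> B" "c \<in> B" for b c
    proof (rule coI)
      have "lincomb (\<lambda>c. if b = c then \<one>\<^bsub>K\<^esub> else \<zero>\<^bsub>K\<^esub>) B
          = (\<Oplus>\<^bsub>V\<^esub>c\<in>B. if b = c then c else \<zero>\<^bsub>V\<^esub>)"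
        unfolding lincomb_def using BV by (intro M.finsum_cong') auto
      also have "\<dots> = b"
        using that fin BV by (intro M.finsum_singleton) auto
      finally show "lincomb (\<lambda>c. if b = c then \<one>\<^bsub>K\<^esub> else \<zero>\<^bsub>K\<^esub>) B = b" .
    qed (use that BV in auto)
  qed (use co co_PiE in auto)
qed

text \<open>A single step of Gaussian elimination modulo \<open>N\<close>: in a relation all of whose other terms lie in
  \<open>N\<close>, the term with nonzero coefficient can be solved for.\<close>

lemma (in vectorspace) pivot_in_submodule:
  assumes N: "submodule K N V" and fin: "finite P" and c: "c \<in> P \<rightarrow> carrier V"
    and w: "w \<in> P \<rightarrow> carrier K"
    and rel: "(\<Oplus>\<^bsub>V\<^esub>p\<in>P. w p \<odot>\<^bsub>V\<^esub> c p) \<in> N"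
    and q: "q \<in> P" "w q \<noteq> \<zero>\<^bsub>K\<^esub>"
    and rest: "\<And>p. \<lbrakk>p \<in> P; p \<noteq> q\<rbrakk> \<Longrightarrow> w p = \<zero>\<^bsub>K\<^esub> \<or> c p \<in> N"
  shows "c q \<in> N"
proof -
  interpret N: submodule K N V by fact
  have NV: "N \<subseteq> carrier V" by (rule N.subset)
  have term_closed: "w p \<odot>\<^bsub>V\<^esub> c p \<in> carrier V" if "p \<in> P" for p
    using that c w by auto
  define s where "s = (\<Oplus>\<^bsub>V\<^esub>p\<in>P - {q}. w p \<odot>\<^bsub>V\<^esub> c p)"
  have sum_in: "(\<Oplus>\<^bsub>V\<^esub>p\<in>A. w p \<odot>\<^bsub>V\<^esub> c p) \<in> N" if "finite A" "A \<subseteq> P - {q}" for A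
    using that
  proof (induction A rule: finite_induct)
    case empty
    then show ?case by simp
  next
    case (insert p A)
    have p: "p \<in> P" "p \<noteq> q" using insert.prems by auto
    have "w p \<odot>\<^bsub>V\<^esub> c p \<in> N"
    proof (cases "c p \<in> N")
      case True
      then show ?thesis using p w by (intro N.smult_closed) auto
    next
      case False
      then have "w p = \<zero>\<^bsub>K\<^esub>" using rest p by blast
      then have "w p \<odot>\<^bsub>V\<^esub> c p = \<zero>\<^bsub>V\<^esub>" using c p by (auto simp: Pi_iff)
      then show ?thesis by simp
    qed
    moreover have "(\<Oplus>\<^bsub>V\<^esub>r\<in>insert p A. w r \<odot>\<^bsub>V\<^esub> c r)
        = w p \<odot>\<^bsub>V\<^esub> c p \<oplus>\<^bsub>V\<^esub> (\<Oplus>\<^bsub>V\<^esub>r\<in>A. w r \<odot>\<^bsub>V\<^esub> c r)"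
      using insert term_closed by (intro M.finsum_insert) auto
    ultimately show ?case using insert by (simp add: N.m_closed)
  qed
  have s: "s \<in> N" unfolding s_def using fin by (intro sum_in) auto
  have "(\<Oplus>\<^bsub>V\<^esub>p\<in>insert q (P - {q}). w p \<odot>\<^bsub>V\<^esub> c p) = w q \<odot>\<^bsub>V\<^esub> c q \<oplus>\<^bsub>V\<^esub> s"
    unfolding s_def using q fin term_closed by (intro M.finsum_insert) auto
  then have wc: "w q \<odot>\<^bsub>V\<^esub> c q \<oplus>\<^bsub>V\<^esub> s \<in> N" using rel q by (simp add: insert_absorb)
  have wqK: "w q \<in> carrier K" and cqV: "c q \<in> carrier V" using q c w by auto
  have wq: "w q \<in> Units K" using q wqK field_Units by auto
  have m1: "\<ominus>\<^bsub>K\<^esub> \<one>\<^bsub>K\<^esub> \<odot>\<^bsub>V\<^esub> s = \<ominus>\<^bsub>V\<^esub> s" using s NV by (auto simp: smult_l_minus)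
  have "(w q \<odot>\<^bsub>V\<^esub> c q \<oplus>\<^bsub>V\<^esub> s) \<oplus>\<^bsub>V\<^esub> (\<ominus>\<^bsub>K\<^esub> \<one>\<^bsub>K\<^esub> \<odot>\<^bsub>V\<^esub> s) \<in> N"
    using s by (intro N.m_closed[OF wc] N.smult_closed) auto
  moreover have "s \<in> carrier V" "w q \<odot>\<^bsub>V\<^esub> c q \<in> carrier V"
    using s NV wqK cqV by auto
  ultimately have "w q \<odot>\<^bsub>V\<^esub> c q \<in> N" by (simp add: m1 M.a_assoc M.r_neg)
  then have "inv\<^bsub>K\<^esub> (w q) \<odot>\<^bsub>V\<^esub> (w q \<odot>\<^bsub>V\<^esub> c q) \<in> N"
    using wq \<open>w q \<odot>\<^bsub>V\<^esub> c q \<in> N\<close> by (intro N.smult_closed[where v = "w q \<odot>\<^bsub>V\<^esub> c q"]) auto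
  moreover have "inv\<^bsub>K\<^esub> (w q) \<odot>\<^bsub>V\<^esub> (w q \<odot>\<^bsub>V\<^esub> c q) = c q"
    using wq wqK cqV by (simp add: smult_assoc1[symmetric])
  ultimately show ?thesis by simp
qed

text \<open>A basis of \<open>L/I\<close> is lifted to elements \<open>e j\<close> of \<open>L\<close>, and its coordinate functionals are pulled
  back to \<open>L\<close>. Indices from \<open>d\<close> on carry junk values (\<open>e j\<close> is any element, \<open>\<kappa> j\<close> is zero), which
  keeps the index type free of side conditions.\<close>

lemma (in lie_ideal) coordinates_modulo_ideal:
  assumes fd: "vectorspace.fin_dim K (lie_quotient L I)"
    and dim: "vectorspace.dim K (lie_quotient L I) = d"
  obtains e :: "nat \<Rightarrow> 'c" and \<kappa> :: "nat \<Rightarrow> 'c \<Rightarrow> 'a"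
    where "\<And>j. e j \<in> carrier L"
      and "\<And>j x. x \<in> carrier L \<Longrightarrow> \<kappa> j x \<in> carrier K"
      and "\<And>j x y. \<lbrakk>x \<in> carrier L; y \<in> carrier L\<rbrakk> \<Longrightarrow> \<kappa> j (x \<oplus> y) = \<kappa> j x \<oplus>\<^bsub>K\<^esub> \<kappa> j y"
      and "\<And>j r x. \<lbrakk>r \<in> carrier K; x \<in> carrier L\<rbrakk> \<Longrightarrow> \<kappa> j (r \<odot> x) = r \<otimes>\<^bsub>K\<^esub> \<kappa> j x"
      and "\<And>i j. \<lbrakk>i < d; j < d\<rbrakk> \<Longrightarrow> \<kappa> i (e j) = (if i = j then \<one>\<^bsub>K\<^esub> else \<zero>\<^bsub>K\<^esub>)"
      and "\<And>j x. x \<in> I \<Longrightarrow> \<kappa> j x = \<zero>\<^bsub>K\<^esub>"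
      and "\<And>x. \<lbrakk>x \<in> carrier L; \<And>j. j < d \<Longrightarrow> \<kappa> j x = \<zero>\<^bsub>K\<^esub>\<rbrakk> \<Longrightarrow> x \<in> I"
proof -
  let ?Q = "lie_quotient L I"
  interpret Q: lie_algebra K ?Q by (rule quotient_lie_algebra)
  obtain B where B: "finite B" "Q.basis B" using Q.finite_basis_exists[OF fd] by blast
  have BQ: "B \<subseteq> carrier ?Q" using B by (simp add: Q.basis_def)
  have "card B = d" using Q.dim_basis[OF B] dim by simp
  then obtain h where h: "bij_betw h {..<d} B"
    using ex_bij_betw_nat_finite[OF B(1)] by (auto simp: atLeast0LessThan)
  have hB: "h j \<in> B" if "j < d" for j using h that by (auto simp: bij_betw_def)
  obtain co where co: "\<And>v. v \<in> carrier ?Q \<Longrightarrow> co v \<in> B \<rightarrow> carrier K"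
    "\<And>v. v \<in> carrier ?Q \<Longrightarrow> Q.lincomb (co v) B = v"
    "\<And>v w b. \<lbrakk>v \<in> carrier ?Q; w \<in> carrier ?Q; b \<in> B\<rbrakk> \<Longrightarrow> co (v \<oplus>\<^bsub>?Q\<^esub> w) b = co v b \<oplus>\<^bsub>K\<^esub> co w b"
    "\<And>r v b. \<lbrakk>r \<in> carrier K; v \<in> carrier ?Q; b \<in> B\<rbrakk> \<Longrightarrow> co (r \<odot>\<^bsub>?Q\<^esub> v) b = r \<otimes>\<^bsub>K\<^esub> co v b"
    "\<And>b c. \<lbrakk>b \<in> B; c \<in> B\<rbrakk> \<Longrightarrow> co b c = (if b = c then \<one>\<^bsub>K\<^esub> else \<zero>\<^bsub>K\<^esub>)"
    using Q.coordinates_wrt_basis[OF B] by blast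
  have "\<exists>x. x \<in> carrier L \<and> (j < d \<longrightarrow> I +> x = h j)" for j
  proof (cases "j < d")
    case True
    then have "h j \<in> carrier ?Q" using hB BQ by blast
    then show ?thesis by (auto simp: quotient_carrier)
  qed (use M.zero_closed in blast)
  then obtain e where e: "\<And>j. e j \<in> carrier L" "\<And>j. j < d \<Longrightarrow> I +> e j = h j" by metis
  define \<kappa> where "\<kappa> j x = (if j < d then co (I +> x) (h j) else \<zero>\<^bsub>K\<^esub>)" for j x
  have cQ: "I +> x \<in> carrier ?Q" if "x \<in> carrier L" for x
    using that by (simp add: quotient_carrier)
  have \<kappa>_closed: "\<kappa> j x \<in> carrier K" if "x \<in> carrier L" for j x
    using co(1)[OF cQ[OF that]] hB[of j] by (auto simp: \<kappa>_def)
  have \<kappa>_smult: "\<kappa> j (r \<odot> x) = r \<otimes>\<^bsub>K\<^esub> \<kappa> j x" if "r \<in> carrier K" "x \<in> carrier L" for j r x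
    using that hB[of j] cQ by (simp add: \<kappa>_def quotient_smult[symmetric] co(4))
  have coset_I: "I +> x = \<zero>\<^bsub>?Q\<^esub> \<longleftrightarrow> x \<in> I" if "x \<in> carrier L" for x
    using that by (simp add: quotient_zero coset_eq_iff M.add.inv_one[simplified] a_inv_def)
  show thesis
  proof (rule that[of e \<kappa>])
    show "\<kappa> j (x \<oplus> y) = \<kappa> j x \<oplus>\<^bsub>K\<^esub> \<kappa> j y" if "x \<in> carrier L" "y \<in> carrier L" for j x y
      using that hB[of j] cQ by (simp add: \<kappa>_def quotient_add[symmetric] co(3))
    show "\<kappa> i (e j) = (if i = j then \<one>\<^bsub>K\<^esub> else \<zero>\<^bsub>K\<^esub>)" if "i < d" "j < d" for i j
      using that h hB co(5)[of "h j" "h i"] by (auto simp: \<kappa>_def e bij_betw_def inj_on_def)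
    show "\<kappa> j x = \<zero>\<^bsub>K\<^esub>" if "x \<in> I" for j x
    proof -
      have "I +> x = I +> \<zero>" using that ideal_carrier coset_I by (simp add: quotient_zero)
      then have "\<kappa> j x = \<kappa> j (\<zero>\<^bsub>K\<^esub> \<odot> \<zero>)" by (simp add: \<kappa>_def)
      also have "\<dots> = \<zero>\<^bsub>K\<^esub>" using \<kappa>_closed by (subst \<kappa>_smult) auto
      finally show ?thesis .
    qed
    show "x \<in> I" if x: "x \<in> carrier L" and 0: "\<And>j. j < d \<Longrightarrow> \<kappa> j x = \<zero>\<^bsub>K\<^esub>" for x
    proof -
      have z: "co (I +> x) b = \<zero>\<^bsub>K\<^esub>" if b: "b \<in> B" for b
      proof -
        obtain j where "j < d" "b = h j" using h b by (auto simp: bij_betw_def)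
        then show ?thesis using 0[of j] by (simp add: \<kappa>_def)
      qed
      have "I +> x = Q.lincomb (co (I +> x)) B" using co(2) cQ x by simp
      also have "\<dots> = (\<Oplus>\<^bsub>?Q\<^esub>b\<in>B. \<zero>\<^bsub>?Q\<^esub>)"
        unfolding Q.lincomb_def using z BQ by (intro Q.M.finsum_cong') auto
      finally show ?thesis using x coset_I by simp
    qed
  qed (use e \<kappa>_closed \<kappa>_smult in auto)
qed

section \<open>Coordinates modulo the center\<close>

definition increasing_pairs :: "nat \<Rightarrow> (nat \<times> nat) set" where
  "increasing_pairs d = {(a, b). a < b \<and> b < d}"

lemma finite_increasing_pairs [simp]: "finite (increasing_pairs d)"
  by (rule finite_subset[of _ "{..<d} \<times> {..<d}"]) (auto simp: increasing_pairs_def)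

lemma card_increasing_pairs: "2 * card (increasing_pairs d) = d * (d - 1)"
proof (induction d)
  case 0
  then show ?case by (simp add: increasing_pairs_def)
next
  case (Suc d)
  have "increasing_pairs (Suc d) = increasing_pairs d \<union> (\<lambda>a. (a, d)) ` {..<d}"
    by (auto simp: increasing_pairs_def)
  moreover have "increasing_pairs d \<inter> (\<lambda>a. (a, d)) ` {..<d} = {}"
    by (auto simp: increasing_pairs_def)
  ultimately have "card (increasing_pairs (Suc d)) = card (increasing_pairs d) + card ((\<lambda>a. (a, d)) ` {..<d})"
    by (simp add: card_Un_disjoint)
  also have "card ((\<lambda>a. (a, d)) ` {..<d}) = d" by (subst card_image) (auto simp: inj_on_def)
  finally show ?case using Suc by (cases d) auto
qed

text \<open>The elements \<open>e j\<close> with \<open>j < d\<close> represent a basis of \<open>L/Z(L)\<close>, and \<open>\<kappa> j\<close> is the \<open>j\<close>-th coordinate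
  modulo the center.\<close>

locale central_coordinates = lie_algebra K L
  for K :: "('k, 'm) ring_scheme" and L :: "('k, 'v, 'n) lie_alg_scheme" (structure) +
  fixes d :: nat and e :: "nat \<Rightarrow> 'v" and \<kappa> :: "nat \<Rightarrow> 'v \<Rightarrow> 'k"
  assumes e_closed [simp, intro]: "e j \<in> carrier L"
    and \<kappa>_closed [simp, intro]: "x \<in> carrier L \<Longrightarrow> \<kappa> j x \<in> carrier K"
    and \<kappa>_add: "\<lbrakk>x \<in> carrier L; y \<in> carrier L\<rbrakk> \<Longrightarrow> \<kappa> j (x \<oplus> y) = \<kappa> j x \<oplus>\<^bsub>K\<^esub> \<kappa> j y"
    and \<kappa>_smult: "\<lbrakk>r \<in> carrier K; x \<in> carrier L\<rbrakk> \<Longrightarrow> \<kappa> j (r \<odot> x) = r \<otimes>\<^bsub>K\<^esub> \<kappa> j x"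
    and \<kappa>_e: "\<lbrakk>i < d; j < d\<rbrakk> \<Longrightarrow> \<kappa> i (e j) = (if i = j then \<one>\<^bsub>K\<^esub> else \<zero>\<^bsub>K\<^esub>)"
    and \<kappa>_center: "z \<in> lie_center L \<Longrightarrow> \<kappa> j z = \<zero>\<^bsub>K\<^esub>"
    and centerI: "\<lbrakk>x \<in> carrier L; \<And>j. j < d \<Longrightarrow> \<kappa> j x = \<zero>\<^bsub>K\<^esub>\<rbrakk> \<Longrightarrow> x \<in> lie_center L"
begin

abbreviation "P \<equiv> increasing_pairs d"

definition e_bracket :: "nat \<times> nat \<Rightarrow> 'v" where "e_bracket p = \<lbrakk>e (fst p), e (snd p)\<rbrakk>"

lemma e_bracket_closed [simp, intro]: "e_bracket p \<in> carrier L"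
  by (simp add: e_bracket_def)

lemma bracket_swap:
  assumes "x \<in> carrier L" "y \<in> carrier L"
  shows "\<lbrakk>y, x\<rbrakk> = \<ominus> \<lbrakk>x, y\<rbrakk>"
proof -
  have "\<zero> = \<lbrakk>x \<oplus> y, x \<oplus> y\<rbrakk>" using assms bracket_self by simp
  also have "\<dots> = (\<lbrakk>x, x\<rbrakk> \<oplus> \<lbrakk>x, y\<rbrakk>) \<oplus> (\<lbrakk>y, x\<rbrakk> \<oplus> \<lbrakk>y, y\<rbrakk>)"
    using assms by (simp add: bracket_add_left bracket_add_right M.a_assoc M.a_lcomm)
  also have "\<dots> = \<lbrakk>y, x\<rbrakk> \<oplus> \<lbrakk>x, y\<rbrakk>"
    using assms by (simp add: bracket_self M.a_comm)
  finally show ?thesis using assms by (intro M.minus_equality[symmetric]) simp_all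
qed

text \<open>The map \<open>\<zeta>\<close> below is the linear projection of \<open>L\<close> onto \<open>Z(L)\<close> along the span of the \<open>e j\<close>.\<close>

definition section_part :: "'v \<Rightarrow> 'v" where
  "section_part x = (\<Oplus>j\<in>{..<d}. \<kappa> j x \<odot> e j)"

definition \<zeta> :: "'v \<Rightarrow> 'v" where "\<zeta> x = x \<oplus> \<ominus> section_part x"

lemma section_part_closed [simp, intro]: "x \<in> carrier L \<Longrightarrow> section_part x \<in> carrier L"
  unfolding section_part_def by (intro M.finsum_closed) auto

lemma section_part_add:
  assumes "x \<in> carrier L" "y \<in> carrier L"
  shows "section_part (x \<oplus> y) = section_part x \<oplus> section_part y"
  unfolding section_part_def using assms
  by (subst M.finsum_addf[symmetric]) (auto simp: \<kappa>_add smult_l_distr intro!: M.finsum_cong')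

lemma section_part_smult:
  assumes "r \<in> carrier K" "x \<in> carrier L"
  shows "section_part (r \<odot> x) = r \<odot> section_part x"
  unfolding section_part_def using assms
  by (subst finsum_smult) (auto simp: \<kappa>_smult smult_assoc1 intro!: M.finsum_cong')

lemma \<zeta>_closed [simp, intro]: "x \<in> carrier L \<Longrightarrow> \<zeta> x \<in> carrier L"
  by (simp add: \<zeta>_def)

lemma \<zeta>_add: "\<lbrakk>x \<in> carrier L; y \<in> carrier L\<rbrakk> \<Longrightarrow> \<zeta> (x \<oplus> y) = \<zeta> x \<oplus> \<zeta> y"
  by (simp add: \<zeta>_def section_part_add M.minus_add M.a_assoc M.a_lcomm)

lemma \<zeta>_smult: "\<lbrakk>r \<in> carrier K; x \<in> carrier L\<rbrakk> \<Longrightarrow> \<zeta> (r \<odot> x) = r \<odot> \<zeta> x"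
  by (simp add: \<zeta>_def section_part_smult smult_r_distr smult_r_minus)

lemma center_closed: "z \<in> lie_center L \<Longrightarrow> z \<in> carrier L"
  by (simp add: lie_center_def)

lemma \<zeta>_center:
  assumes "z \<in> lie_center L"
  shows "\<zeta> z = z"
proof -
  have "section_part z = (\<Oplus>j\<in>{..<d}. \<zero>)"
    unfolding section_part_def using assms by (intro M.finsum_cong') (auto simp: \<kappa>_center)
  then show ?thesis using assms by (simp add: \<zeta>_def center_closed)
qed

lemma \<kappa>_finsum:
  assumes "finite A" "f \<in> A \<rightarrow> carrier L"
  shows "\<kappa> j (\<Oplus>a\<in>A. f a) = (\<Oplus>\<^bsub>K\<^esub>a\<in>A. \<kappa> j (f a))"
  using assms
proof (induction A rule: finite_induct)
  case empty
  have "\<zero> \<in> lie_center L" by (simp add: lie_center_def)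
  then show ?case by (simp add: \<kappa>_center)
next
  case (insert a A)
  have "(\<Oplus>a\<in>A. f a) \<in> carrier L" using insert by (intro M.finsum_closed) auto
  moreover have "(\<lambda>a. \<kappa> j (f a)) \<in> A \<rightarrow> carrier K" using insert by auto
  ultimately show ?case using insert by (simp add: \<kappa>_add Pi_iff)
qed

lemma \<kappa>_section_part:
  assumes x: "x \<in> carrier L" and i: "i < d"
  shows "\<kappa> i (section_part x) = \<kappa> i x"
proof -
  have "\<kappa> i (section_part x) = (\<Oplus>\<^bsub>K\<^esub>j\<in>{..<d}. \<kappa> i (\<kappa> j x \<odot> e j))"
    unfolding section_part_def using x by (intro \<kappa>_finsum) auto
  also have "\<dots> = (\<Oplus>\<^bsub>K\<^esub>j\<in>{..<d}. if i = j then \<kappa> j x else \<zero>\<^bsub>K\<^esub>)"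
    using x i by (intro R.finsum_cong') (auto simp: \<kappa>_smult \<kappa>_e)
  also have "\<dots> = \<kappa> i x" using x i by (intro R.finsum_singleton) auto
  finally show ?thesis .
qed

lemma \<zeta>_in_center:
  assumes x: "x \<in> carrier L"
  shows "\<zeta> x \<in> lie_center L"
proof (rule centerI)
  fix j assume j: "j < d"
  have "\<ominus> section_part x = (\<ominus>\<^bsub>K\<^esub> \<one>\<^bsub>K\<^esub>) \<odot> section_part x"
    using x by (simp add: smult_l_minus)
  then have "\<kappa> j (\<ominus> section_part x) = \<ominus>\<^bsub>K\<^esub> \<kappa> j x"
    using x j by (simp add: \<kappa>_smult \<kappa>_section_part R.l_minus)
  then show "\<kappa> j (\<zeta> x) = \<zero>\<^bsub>K\<^esub>" using x by (simp add: \<zeta>_def \<kappa>_add R.r_neg)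
qed (use x in simp)

text \<open>Every \<open>x\<close> is the sum of its part in the span of the \<open>e j\<close> and of the central element \<open>\<zeta> x\<close>.\<close>

lemma hom_eqI:
  assumes F: "F \<in> module_hom K L L" and G: "G \<in> module_hom K L L"
    and center: "\<And>z. z \<in> lie_center L \<Longrightarrow> F z = G z"
    and basis: "\<And>j. j < d \<Longrightarrow> F (e j) = G (e j)"
    and x: "x \<in> carrier L"
  shows "F x = G x"
proof -
  have "module K L" ..
  then interpret F: mod_hom K L L F using F by (simp add: mod_hom_def mod_hom_axioms_def)
  interpret G: mod_hom K L L G using \<open>module K L\<close> G by (simp add: mod_hom_def mod_hom_axioms_def)
  have sum: "F (\<Oplus>j\<in>A. \<kappa> j x \<odot> e j) = G (\<Oplus>j\<in>A. \<kappa> j x \<odot> e j)" if "finite A" "A \<subseteq> {..<d}" for A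
    using that
  proof (induction A rule: finite_induct)
    case empty
    then show ?case by simp
  next
    case (insert j A)
    have "(\<Oplus>j\<in>A. \<kappa> j x \<odot> e j) \<in> carrier L" using x by (intro M.finsum_closed) auto
    then show ?case
      using insert x basis by (simp add: Pi_iff)
  qed
  have "x = section_part x \<oplus> \<zeta> x"
    using x by (simp add: \<zeta>_def M.a_lcomm M.r_neg)
  moreover have "F (section_part x \<oplus> \<zeta> x) = G (section_part x \<oplus> \<zeta> x)"
    using x sum[of "{..<d}"] \<zeta>_in_center[OF x] by (simp add: section_part_def[symmetric] center)
  ultimately show ?thesis by simp
qed

end

section \<open>Alternating arrays and Jacobi relations\<close>

text \<open>The coefficients of an element of the third exterior power. The diagonal is required to vanish
  separately, since in characteristic 2 skew-symmetry does not imply it.\<close>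

definition alternating_array :: "('k, 'm) ring_scheme \<Rightarrow> (nat \<Rightarrow> nat \<Rightarrow> nat \<Rightarrow> 'k) \<Rightarrow> bool" where
  "alternating_array K t \<longleftrightarrow> (\<forall>i j k. t i j k \<in> carrier K \<and> t i i k = \<zero>\<^bsub>K\<^esub>
    \<and> t j i k = \<ominus>\<^bsub>K\<^esub> t i j k \<and> t j k i = t i j k)"

text \<open>As a vector space this stands in for \<open>L \<otimes> L/Z(L)\<close>: the sequence \<open>s\<close> represents the sum of the
  \<open>s k \<otimes> e k\<close> with \<open>k < d\<close>, and later entries do not matter. The zero bracket makes quotients by arbitrary subspaces available as
  quotients of Lie algebras by ideals.\<close>

definition sequence_space :: "('k, 'v, 'n) lie_alg_scheme \<Rightarrow> ('k, nat \<Rightarrow> 'v) lie_alg" where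
  "sequence_space L = \<lparr> carrier = {s. \<forall>j. s j \<in> carrier L}, mult = (\<lambda>s t. s), one = (\<lambda>j. \<zero>\<^bsub>L\<^esub>),
    zero = (\<lambda>j. \<zero>\<^bsub>L\<^esub>), add = (\<lambda>s t j. s j \<oplus>\<^bsub>L\<^esub> t j), smult = (\<lambda>r s j. r \<odot>\<^bsub>L\<^esub> s j),
    bracket = (\<lambda>s t j. \<zero>\<^bsub>L\<^esub>) \<rparr>"

lemma sequence_space_simps:
  "carrier (sequence_space L) = {s. \<forall>j. s j \<in> carrier L}"
  "\<zero>\<^bsub>sequence_space L\<^esub> = (\<lambda>j. \<zero>\<^bsub>L\<^esub>)"
  "s \<oplus>\<^bsub>sequence_space L\<^esub> t = (\<lambda>j. s j \<oplus>\<^bsub>L\<^esub> t j)"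
  "r \<odot>\<^bsub>sequence_space L\<^esub> s = (\<lambda>j. r \<odot>\<^bsub>L\<^esub> s j)"
  "\<lbrakk>s, t\<rbrakk>\<^bsub>sequence_space L\<^esub> = (\<lambda>j. \<zero>\<^bsub>L\<^esub>)"
  by (simp_all add: sequence_space_def)

lemma (in lie_algebra) sequence_space_lie_algebra: "lie_algebra K (sequence_space L)"
proof -
  have vs: "vectorspace K (sequence_space L)"
  proof (rule vs_criteria)
    show "field K" by (rule field_axioms)
    show "\<forall>s\<in>carrier (sequence_space L). \<exists>t\<in>carrier (sequence_space L).
        s \<oplus>\<^bsub>sequence_space L\<^esub> t = \<zero>\<^bsub>sequence_space L\<^esub>"
    proof
      fix s assume "s \<in> carrier (sequence_space L)"
      then show "\<exists>t\<in>carrier (sequence_space L). s \<oplus>\<^bsub>sequence_space L\<^esub> t = \<zero>\<^bsub>sequence_space L\<^esub>"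
        by (intro bexI[of _ "\<lambda>j. \<ominus> s j"]) (auto simp: sequence_space_simps M.r_neg)
    qed
  qed (auto simp: sequence_space_simps M.a_ac smult_l_distr smult_r_distr smult_assoc1)
  show ?thesis
    by (intro lie_algebra.intro vs lie_algebra_axioms.intro) (auto simp: sequence_space_simps)
qed

lemma sequence_space_lie_ideal:
  assumes "lie_algebra K L" "submodule K S (sequence_space L)"
  shows "lie_ideal K (sequence_space L) S"
proof -
  interpret S: submodule K S "sequence_space L" by fact
  show ?thesis
    using S.zero_closed
    by (intro lie_ideal.intro lie_ideal_axioms.intro lie_algebra.sequence_space_lie_algebra assms)
       (simp_all add: sequence_space_simps)
qed

context central_coordinates
begin

text \<open>For coefficients \<open>w\<close> of a bivector, its image under the map from the second exterior power of
  \<open>L/Z(L)\<close> to \<open>Z(L)\<close> that the bracket induces.\<close>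

definition pair_sum :: "(nat \<Rightarrow> nat \<Rightarrow> 'k) \<Rightarrow> 'v" where
  "pair_sum w = (\<Oplus>p\<in>P. w (fst p) (snd p) \<odot> e_bracket p)"

lemma pair_sum_closed [simp, intro]:
  "(\<And>i j. w i j \<in> carrier K) \<Longrightarrow> pair_sum w \<in> carrier L"
  unfolding pair_sum_def by (intro M.finsum_closed) auto

lemma pair_sum_cong:
  assumes "\<And>i j. w' i j \<in> carrier K" "\<And>i j. \<lbrakk>i < j; j < d\<rbrakk> \<Longrightarrow> w i j = w' i j"
  shows "pair_sum w = pair_sum w'"
  unfolding pair_sum_def using assms
  by (intro M.finsum_cong') (auto simp: increasing_pairs_def)

lemma pair_sum_add:
  assumes "\<And>i j. w i j \<in> carrier K" "\<And>i j. w' i j \<in> carrier K"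
  shows "pair_sum (\<lambda>i j. w i j \<oplus>\<^bsub>K\<^esub> w' i j) = pair_sum w \<oplus> pair_sum w'"
  unfolding pair_sum_def using assms
  by (subst M.finsum_addf[symmetric]) (auto simp: smult_l_distr intro!: M.finsum_cong')

lemma pair_sum_smult:
  assumes "r \<in> carrier K" "\<And>i j. w i j \<in> carrier K"
  shows "pair_sum (\<lambda>i j. r \<otimes>\<^bsub>K\<^esub> w i j) = r \<odot> pair_sum w"
  unfolding pair_sum_def using assms
  by (subst finsum_smult) (auto simp: smult_assoc1 intro!: M.finsum_cong')

lemma pair_sum_zero: "pair_sum (\<lambda>i j. \<zero>\<^bsub>K\<^esub>) = \<zero>"
proof -
  have "pair_sum (\<lambda>i j. \<zero>\<^bsub>K\<^esub>) = (\<Oplus>p\<in>P. \<zero>)"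
    unfolding pair_sum_def by (intro M.finsum_cong') auto
  then show ?thesis by simp
qed

lemma pair_sum_single:
  assumes "a < b" "b < d"
  shows "pair_sum (\<lambda>i j. if i = a \<and> j = b then \<one>\<^bsub>K\<^esub> else \<zero>\<^bsub>K\<^esub>) = \<lbrakk>e a, e b\<rbrakk>"
proof -
  have "pair_sum (\<lambda>i j. if i = a \<and> j = b then \<one>\<^bsub>K\<^esub> else \<zero>\<^bsub>K\<^esub>)
      = (\<Oplus>p\<in>P. if (a, b) = p then e_bracket p else \<zero>)"
    unfolding pair_sum_def by (intro M.finsum_cong') auto
  also have "\<dots> = e_bracket (a, b)"
    using assms by (intro M.finsum_singleton finite_increasing_pairs) (auto simp: increasing_pairs_def)
  finally show ?thesis by (simp add: e_bracket_def)
qed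

definition minor :: "'v \<Rightarrow> 'v \<Rightarrow> nat \<Rightarrow> nat \<Rightarrow> 'k" where
  "minor x y i j = \<kappa> i x \<otimes>\<^bsub>K\<^esub> \<kappa> j y \<ominus>\<^bsub>K\<^esub> \<kappa> j x \<otimes>\<^bsub>K\<^esub> \<kappa> i y"

lemma minor_closed [simp, intro]:
  "\<lbrakk>x \<in> carrier L; y \<in> carrier L\<rbrakk> \<Longrightarrow> minor x y i j \<in> carrier K"
  by (simp add: minor_def)

lemma minor_swap:
  assumes "x \<in> carrier L" "y \<in> carrier L"
  shows "minor y x i j = \<ominus>\<^bsub>K\<^esub> \<one>\<^bsub>K\<^esub> \<otimes>\<^bsub>K\<^esub> minor x y i j"
  using assms by (simp add: minor_def R.minus_eq R.l_minus R.minus_add R.m_comm R.a_comm)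

lemma minor_add_left:
  assumes "x \<in> carrier L" "y \<in> carrier L" "z \<in> carrier L"
  shows "minor (x \<oplus> y) z i j = minor x z i j \<oplus>\<^bsub>K\<^esub> minor y z i j"
  using assms unfolding minor_def \<kappa>_add[OF assms(1,2)]
  by (simp add: R.minus_eq R.l_minus R.r_minus R.minus_add R.l_distr R.r_distr R.a_ac R.m_ac)

lemma minor_smult_left:
  assumes "r \<in> carrier K" "x \<in> carrier L" "y \<in> carrier L"
  shows "minor (r \<odot> x) y i j = r \<otimes>\<^bsub>K\<^esub> minor x y i j"
  using assms unfolding minor_def \<kappa>_smult[OF assms(1,2)]
  by (simp add: R.minus_eq R.l_minus R.r_minus R.minus_add R.l_distr R.r_distr R.a_ac R.m_ac)

lemma minor_center_left: "\<lbrakk>z \<in> lie_center L; y \<in> carrier L\<rbrakk> \<Longrightarrow> minor z y i j = \<zero>\<^bsub>K\<^esub>"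
  by (simp add: minor_def \<kappa>_center R.minus_eq)

lemma minor_self: "x \<in> carrier L \<Longrightarrow> minor x x i j = \<zero>\<^bsub>K\<^esub>"
  by (simp add: minor_def R.m_comm R.minus_eq R.r_neg)

lemma pair_sum_minor_swap:
  assumes "x \<in> carrier L" "y \<in> carrier L"
  shows "pair_sum (minor y x) = \<ominus> pair_sum (minor x y)"
proof -
  have "pair_sum (minor y x) = pair_sum (\<lambda>i j. \<ominus>\<^bsub>K\<^esub> \<one>\<^bsub>K\<^esub> \<otimes>\<^bsub>K\<^esub> minor x y i j)"
    using assms by (simp add: minor_swap[OF assms, abs_def])
  also have "\<dots> = (\<ominus>\<^bsub>K\<^esub> \<one>\<^bsub>K\<^esub>) \<odot> pair_sum (minor x y)"
    using assms by (intro pair_sum_smult) auto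
  finally show ?thesis using assms by (simp add: smult_l_minus)
qed

lemma pair_sum_minor_hom:
  assumes y: "y \<in> carrier L"
  shows "(\<lambda>x. pair_sum (minor x y)) \<in> module_hom K L L"
proof -
  have "pair_sum (minor (x \<oplus> z) y) = pair_sum (minor x y) \<oplus> pair_sum (minor z y)"
    if "x \<in> carrier L" "z \<in> carrier L" for x z
    using that y
    by (subst pair_sum_add[symmetric]) (auto simp: minor_add_left intro!: pair_sum_cong)
  moreover have "pair_sum (minor (r \<odot> x) y) = r \<odot> pair_sum (minor x y)"
    if "r \<in> carrier K" "x \<in> carrier L" for r x
    using that y
    by (subst pair_sum_smult[symmetric]) (auto simp: minor_smult_left intro!: pair_sum_cong)
  ultimately show ?thesis using y by (simp add: module_hom_def)
qed

lemma bracket_hom: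
  "y \<in> carrier L \<Longrightarrow> (\<lambda>x. \<lbrakk>x, y\<rbrakk>) \<in> module_hom K L L"
  by (simp add: module_hom_def bracket_add_left bracket_smult_left)

lemma bracket_basis_eq_pair_sum:
  assumes "i < d" "j < d"
  shows "\<lbrakk>e i, e j\<rbrakk> = pair_sum (minor (e i) (e j))"
proof -
  have less: "\<lbrakk>e a, e b\<rbrakk> = pair_sum (minor (e a) (e b))" if "a < b" "b < d" for a b
  proof -
    have "pair_sum (minor (e a) (e b)) = pair_sum (\<lambda>i j. if i = a \<and> j = b then \<one>\<^bsub>K\<^esub> else \<zero>\<^bsub>K\<^esub>)"
      using that by (intro pair_sum_cong) (auto simp: minor_def \<kappa>_e R.minus_eq)
    then show ?thesis using that by (simp add: pair_sum_single)
  qed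
  consider "i < j" | "i = j" | "j < i" by linarith
  then show ?thesis
  proof cases
    case 1
    then show ?thesis using less assms by blast
  next
    case 2
    have "pair_sum (minor (e j) (e j)) = pair_sum (\<lambda>i j. \<zero>\<^bsub>K\<^esub>)"
      by (intro pair_sum_cong) (auto simp: minor_self)
    then show ?thesis using 2 by (simp add: bracket_self pair_sum_zero)
  next
    case 3
    then show ?thesis
      using less[of j i] assms bracket_swap[of "e j" "e i"] pair_sum_minor_swap[of "e j" "e i"] by simp
  qed
qed

text \<open>Both sides are bilinear and vanish when one argument is central, so it is enough to compare them
  on the \<open>e j\<close>; skew-symmetry carries the comparison from the first argument to the second.\<close>

lemma bracket_eq_pair_sum:
  assumes x: "x \<in> carrier L" and y: "y \<in> carrier L"
  shows "\<lbrakk>x, y\<rbrakk> = pair_sum (minor x y)"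
proof -
  have zero: "pair_sum (minor z u) = \<zero>" if "z \<in> lie_center L" "u \<in> carrier L" for z u
  proof -
    have "pair_sum (minor z u) = pair_sum (\<lambda>i j. \<zero>\<^bsub>K\<^esub>)"
      using that by (intro pair_sum_cong) (auto simp: minor_center_left)
    then show ?thesis by (simp add: pair_sum_zero)
  qed
  have half: "\<lbrakk>u, e j\<rbrakk> = pair_sum (minor u (e j))" if "j < d" "u \<in> carrier L" for j u
    by (rule hom_eqI[OF bracket_hom pair_sum_minor_hom])
       (use that in \<open>auto simp: zero lie_center_def bracket_basis_eq_pair_sum\<close>)
  have basis: "\<lbrakk>e j, y\<rbrakk> = pair_sum (minor (e j) y)" if "j < d" for j
    using half[OF that y] y bracket_swap[of y "e j"] pair_sum_minor_swap[of y "e j"] by simp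
  show ?thesis
    by (rule hom_eqI[OF bracket_hom pair_sum_minor_hom])
       (use x y basis zero in \<open>auto simp: lie_center_def\<close>)
qed

end

lemma alternating_arrayD:
  assumes "alternating_array K t"
  shows "t i j k \<in> carrier K" "t i i k = \<zero>\<^bsub>K\<^esub>" "t j i k = \<ominus>\<^bsub>K\<^esub> t i j k" "t i j k = t j k i"
  using assms unfolding alternating_array_def by metis+

lemma alternating_array_zero:
  assumes "cring K"
  shows "alternating_array K (\<lambda>i j k. \<zero>\<^bsub>K\<^esub>)"
proof -
  interpret cring K by fact
  show ?thesis by (simp add: alternating_array_def)
qed

lemma alternating_array_add:
  assumes "cring K" "alternating_array K t" "alternating_array K t'"
  shows "alternating_array K (\<lambda>i j k. t i j k \<oplus>\<^bsub>K\<^esub> t' i j k)"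
proof -
  interpret cring K by fact
  show ?thesis
    using alternating_arrayD[OF assms(2)] alternating_arrayD[OF assms(3)]
    unfolding alternating_array_def by (metis a_closed l_zero minus_add zero_closed)
qed

lemma alternating_array_smult:
  assumes "cring K" "r \<in> carrier K" "alternating_array K t"
  shows "alternating_array K (\<lambda>i j k. r \<otimes>\<^bsub>K\<^esub> t i j k)"
proof -
  interpret cring K by fact
  show ?thesis
    using alternating_arrayD[OF assms(3)] assms(2)
    unfolding alternating_array_def by (metis m_closed r_null r_minus)
qed

text \<open>The 3-by-3 determinant with rows \<open>(a, b, c)\<close>, \<open>(a', b', c')\<close>, \<open>(a'', b'', c'')\<close>, expanded along its
  last and along its first column.\<close>

lemma (in cring) determinant_expansion:
  assumes "a \<in> carrier R" "b \<in> carrier R" "c \<in> carrier R"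
    "a' \<in> carrier R" "b' \<in> carrier R" "c' \<in> carrier R"
    "a'' \<in> carrier R" "b'' \<in> carrier R" "c'' \<in> carrier R"
  shows "c \<otimes> (a' \<otimes> b'' \<ominus> b' \<otimes> a'') \<oplus> c' \<otimes> (a'' \<otimes> b \<ominus> b'' \<otimes> a) \<oplus> c'' \<otimes> (a \<otimes> b' \<ominus> b \<otimes> a')
    = a \<otimes> (b' \<otimes> c'' \<ominus> c' \<otimes> b'') \<oplus> a' \<otimes> (b'' \<otimes> c \<ominus> c'' \<otimes> b) \<oplus> a'' \<otimes> (b \<otimes> c' \<ominus> c \<otimes> b')"
  using assms
  apply (simp add: minus_eq r_minus r_distr)
  apply (simp add: assms m_ac)
  apply (simp add: assms a_ac)
  done

locale heisenberg_coordinates = central_coordinates +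
  assumes derived_eq_center: "lie_derived K L = lie_center L"
begin

lemma bracket_in_center:
  assumes "x \<in> carrier L" "y \<in> carrier L"
  shows "\<lbrakk>x, y\<rbrakk> \<in> lie_center L"
proof -
  let ?B = "{\<lbrakk>x, y\<rbrakk> | x y. x \<in> carrier L \<and> y \<in> carrier L}"
  have "?B \<subseteq> span ?B" by (intro in_own_span) auto
  then show ?thesis using assms unfolding derived_eq_center[symmetric] lie_derived_def by blast
qed

text \<open>The image of the third exterior power of \<open>L/Z(L)\<close> in \<open>Z(L) \<otimes> L/Z(L)\<close> under
  \<open>x \<and> y \<and> z \<mapsto> [x, y] \<otimes> z + [y, z] \<otimes> x + [z, x] \<otimes> y\<close>: exactly what must be divided out to make the
  tautological map \<open>(z, x) \<mapsto> z \<otimes> x\<close> a cocycle.\<close>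

definition jacobi_relations :: "(nat \<Rightarrow> 'c) set" where
  "jacobi_relations = {\<lambda>k. pair_sum (\<lambda>i j. t i j k) | t. alternating_array K t}"

lemma jacobi_relationsI:
  "alternating_array K t \<Longrightarrow> (\<lambda>k. pair_sum (\<lambda>i j. t i j k)) \<in> jacobi_relations"
  by (auto simp: jacobi_relations_def)

lemma jacobi_relations_submodule: "submodule K jacobi_relations (sequence_space L)"
proof -
  interpret Seq: lie_algebra K "sequence_space L" by (rule sequence_space_lie_algebra)
  have cr: "cring K" ..
  show ?thesis
  proof (unfold_locales)
    show "jacobi_relations \<subseteq> carrier (sequence_space L)"
      by (auto simp: jacobi_relations_def sequence_space_simps alternating_arrayD(1))
    show "\<zero>\<^bsub>sequence_space L\<^esub> \<in> jacobi_relations"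
      unfolding jacobi_relations_def
      by (auto simp: sequence_space_simps pair_sum_zero
          intro!: exI[of _ "\<lambda>i j k. \<zero>\<^bsub>K\<^esub>"] alternating_array_zero[OF cr])
  next
    fix s s' assume "s \<in> jacobi_relations" "s' \<in> jacobi_relations"
    then obtain t t' where t: "alternating_array K t" "s = (\<lambda>k. pair_sum (\<lambda>i j. t i j k))"
      and t': "alternating_array K t'" "s' = (\<lambda>k. pair_sum (\<lambda>i j. t' i j k))"
      unfolding jacobi_relations_def by blast
    have "s \<oplus>\<^bsub>sequence_space L\<^esub> s' = (\<lambda>k. pair_sum (\<lambda>i j. t i j k \<oplus>\<^bsub>K\<^esub> t' i j k))"
      using t t' by (simp add: sequence_space_simps pair_sum_add alternating_arrayD(1))
    then show "s \<oplus>\<^bsub>sequence_space L\<^esub> s' \<in> jacobi_relations"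
      using jacobi_relationsI[OF alternating_array_add[OF cr t(1) t'(1)]] by simp
  next
    fix r s assume r: "r \<in> carrier K" and "s \<in> jacobi_relations"
    then obtain t where t: "alternating_array K t" "s = (\<lambda>k. pair_sum (\<lambda>i j. t i j k))"
      unfolding jacobi_relations_def by blast
    have "r \<odot>\<^bsub>sequence_space L\<^esub> s = (\<lambda>k. pair_sum (\<lambda>i j. r \<otimes>\<^bsub>K\<^esub> t i j k))"
      using t r by (simp add: sequence_space_simps pair_sum_smult alternating_arrayD(1))
    then show "r \<odot>\<^bsub>sequence_space L\<^esub> s \<in> jacobi_relations"
      using jacobi_relationsI[OF alternating_array_smult[OF cr r t(1)]] by simp
  qed
qed

text \<open>These are the 3-by-3 minors of the coordinates of \<open>x\<close>, \<open>y\<close>, \<open>z\<close>, expanded along the column \<open>k\<close>.\<close>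

lemma alternating_array_minor:
  assumes xyz: "x \<in> carrier L" "y \<in> carrier L" "z \<in> carrier L"
  shows "alternating_array K (\<lambda>i j k. \<kappa> k x \<otimes>\<^bsub>K\<^esub> minor y z i j
    \<oplus>\<^bsub>K\<^esub> \<kappa> k y \<otimes>\<^bsub>K\<^esub> minor z x i j \<oplus>\<^bsub>K\<^esub> \<kappa> k z \<otimes>\<^bsub>K\<^esub> minor x y i j)"
proof -
  have swap: "minor u v j i = \<ominus>\<^bsub>K\<^esub> minor u v i j" and diag: "minor u v i i = \<zero>\<^bsub>K\<^esub>"
    if "u \<in> carrier L" "v \<in> carrier L" for u v i j
    using that by (simp_all add: minor_def R.minus_eq R.minus_add R.r_neg R.a_comm)
  have cyclic: "\<kappa> k x \<otimes>\<^bsub>K\<^esub> minor y z i j \<oplus>\<^bsub>K\<^esub> \<kappa> k y \<otimes>\<^bsub>K\<^esub> minor z x i j \<oplus>\<^bsub>K\<^esub> \<kappa> k z \<otimes>\<^bsub>K\<^esub> minor x y i j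
      = \<kappa> i x \<otimes>\<^bsub>K\<^esub> minor y z j k \<oplus>\<^bsub>K\<^esub> \<kappa> i y \<otimes>\<^bsub>K\<^esub> minor z x j k \<oplus>\<^bsub>K\<^esub> \<kappa> i z \<otimes>\<^bsub>K\<^esub> minor x y j k" for i j k
    unfolding minor_def by (rule R.determinant_expansion) (use xyz in simp_all)
  show ?thesis
    unfolding alternating_array_def
  proof (intro allI conjI)
    fix i j k
    let ?t = "\<lambda>i j k. \<kappa> k x \<otimes>\<^bsub>K\<^esub> minor y z i j
      \<oplus>\<^bsub>K\<^esub> \<kappa> k y \<otimes>\<^bsub>K\<^esub> minor z x i j \<oplus>\<^bsub>K\<^esub> \<kappa> k z \<otimes>\<^bsub>K\<^esub> minor x y i j"
    show "?t i j k \<in> carrier K" using xyz by simp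
    show "?t i i k = \<zero>\<^bsub>K\<^esub>" using xyz by (simp add: diag)
    show "?t j i k = \<ominus>\<^bsub>K\<^esub> ?t i j k"
      using xyz by (simp add: swap[of _ _ j i] R.r_minus R.minus_add)
    show "?t j k i = ?t i j k" by (rule cyclic[symmetric])
  qed
qed

lemma jacobi_in_relations:
  assumes xyz: "x \<in> carrier L" "y \<in> carrier L" "z \<in> carrier L"
  shows "(\<lambda>k. \<kappa> k x \<odot> \<lbrakk>y, z\<rbrakk> \<oplus> \<kappa> k y \<odot> \<lbrakk>z, x\<rbrakk> \<oplus> \<kappa> k z \<odot> \<lbrakk>x, y\<rbrakk>) \<in> jacobi_relations"
proof -
  have "\<kappa> k x \<odot> \<lbrakk>y, z\<rbrakk> \<oplus> \<kappa> k y \<odot> \<lbrakk>z, x\<rbrakk> \<oplus> \<kappa> k z \<odot> \<lbrakk>x, y\<rbrakk> = pair_sum (\<lambda>i j. \<kappa> k x \<otimes>\<^bsub>K\<^esub> minor y z i j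
    \<oplus>\<^bsub>K\<^esub> \<kappa> k y \<otimes>\<^bsub>K\<^esub> minor z x i j \<oplus>\<^bsub>K\<^esub> \<kappa> k z \<otimes>\<^bsub>K\<^esub> minor x y i j)" for k
    using xyz by (simp add: pair_sum_add pair_sum_smult bracket_eq_pair_sum)
  then show ?thesis
    using jacobi_relationsI[OF alternating_array_minor[OF xyz]] by simp
qed

text \<open>The derived algebra, hence the center, is spanned by the brackets of the \<open>e j\<close>.\<close>

lemma dim_center_le_card:
  assumes fin: "finite T" and T: "T \<subseteq> lie_center L" and e_bracket: "\<And>p. p \<in> P \<Longrightarrow> e_bracket p \<in> span T"
  shows "vectorspace.dim K (L\<lparr>carrier := lie_center L\<rparr>) \<le> card T"
proof -
  interpret Z: lie_ideal K L "lie_center L" by (rule center_lie_ideal)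
  have TL: "T \<subseteq> carrier L" using T center_closed by blast
  interpret T: submodule K "span T" L by (rule span_is_submodule[OF TL])
  have sum_in: "(\<Oplus>p\<in>A. w p \<odot> e_bracket p) \<in> span T"
    if "finite A" "A \<subseteq> P" "\<And>p. w p \<in> carrier K" for A w
    using that
  proof (induction A rule: finite_induct)
    case empty
    then show ?case by simp
  next
    case (insert p A)
    then have "(\<Oplus>r\<in>insert p A. w r \<odot> e_bracket r) = w p \<odot> e_bracket p \<oplus> (\<Oplus>r\<in>A. w r \<odot> e_bracket r)"
      by (intro M.finsum_insert) auto
    moreover have "w p \<odot> e_bracket p \<in> span T" using insert.prems e_bracket by (intro T.smult_closed) auto
    ultimately show ?case using insert by simp
  qed
  have "\<lbrakk>x, y\<rbrakk> \<in> span T" if "x \<in> carrier L" "y \<in> carrier L" for x y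
    using that by (simp add: bracket_eq_pair_sum pair_sum_def sum_in)
  then have "lie_derived K L \<subseteq> span T"
    unfolding lie_derived_def by (intro span_is_subset T.submodule_axioms) auto
  moreover have "span T \<subseteq> lie_center L"
    by (intro span_is_subset T Z.ideal_submodule)
  ultimately have "span T = lie_center L" using derived_eq_center by blast
  moreover have sub: "subspace K (lie_center L) L"
    by (simp add: subspace_def Z.ideal_submodule vectorspace_axioms)
  interpret VZ: vectorspace K "vs (lie_center L)" by (rule subspace_is_vs[OF sub])
  have "VZ.span T = span T" by (rule span_li_not_depend(1)[OF T Z.ideal_submodule])
  ultimately show ?thesis
    by (intro VZ.gen_ge_dim fin) (simp_all add: T)
qed

end

section \<open>Few relations among the brackets\<close>

context heisenberg_coordinates
begin

lemma pair_sum_pivot_in_submodule: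
  assumes N: "submodule K N L" and w: "\<And>i j. w i j \<in> carrier K"
    and rel: "pair_sum w \<in> N"
    and p: "i < j" "j < d" "w i j \<noteq> \<zero>\<^bsub>K\<^esub>"
    and rest: "\<And>i' j'. \<lbrakk>i' < j'; j' < d; (i', j') \<noteq> (i, j)\<rbrakk> \<Longrightarrow> w i' j' = \<zero>\<^bsub>K\<^esub> \<or> e_bracket (i', j') \<in> N"
  shows "e_bracket (i, j) \<in> N"
proof (rule pivot_in_submodule[OF N finite_increasing_pairs[of d], where w = "\<lambda>p. w (fst p) (snd p)"])
  show "(\<Oplus>p\<in>P. w (fst p) (snd p) \<odot> e_bracket p) \<in> N" using rel by (simp add: pair_sum_def)
  show "w (fst p) (snd p) = \<zero>\<^bsub>K\<^esub> \<or> e_bracket p \<in> N" if "p \<in> P" "p \<noteq> (i, j)" for p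
    using rest[of "fst p" "snd p"] that by (cases p) (auto simp: increasing_pairs_def)
qed (use w p in \<open>auto simp: increasing_pairs_def\<close>)

text \<open>The bivectors \<open>w\<close> whose image is a multiple of \<open>z\<close> form a space \<open>W\<close> of dimension at most 3, by the
  dimension hypothesis. The contractions of \<open>t\<close> at \<open>a\<close>, \<open>b\<close> and \<open>0\<close> lie in \<open>W\<close>, and on the coordinates
  \<open>(0, b)\<close>, \<open>(0, a)\<close>, \<open>(a, b)\<close> they form a diagonal matrix with the entries \<open>\<plusminus>t a b 0\<close>. So they are a
  basis of \<open>W\<close>, and these three coordinates determine an element of \<open>W\<close>. The proof reads this as
  an elimination: a fourth independent relation would leave too few generators for the center.\<close>

lemma relation_vanishes:
  assumes card: "card P \<le> vectorspace.dim K (L\<lparr>carrier := lie_center L\<rparr>) + 2"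
    and z: "z \<in> lie_center L"
    and t: "alternating_array K t"
    and rows: "\<And>k. k < d \<Longrightarrow> \<exists>r\<in>carrier K. pair_sum (\<lambda>i j. t i j k) = r \<odot> z"
    and ab: "0 < a" "a < b" "b < d" "t a b 0 \<noteq> \<zero>\<^bsub>K\<^esub>"
    and w: "\<And>i j. w i j \<in> carrier K"
    and rel: "\<exists>r\<in>carrier K. pair_sum w = r \<odot> z"
    and w0: "w a b = \<zero>\<^bsub>K\<^esub>" "w 0 a = \<zero>\<^bsub>K\<^esub>" "w 0 b = \<zero>\<^bsub>K\<^esub>"
    and ij: "i < j" "j < d"
  shows "w i j = \<zero>\<^bsub>K\<^esub>"
proof (rule ccontr)
  assume nz: "w i j \<noteq> \<zero>\<^bsub>K\<^esub>"
  define R where "R = P - {(i, j), (a, b), (0, a), (0, b)}"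
  define T where "T = insert z (e_bracket ` R)"
  have cZ: "e_bracket p \<in> lie_center L" for p by (simp add: e_bracket_def bracket_in_center)
  have T: "finite T" "T \<subseteq> lie_center L"
    using z cZ by (auto simp: T_def R_def)
  then have TL: "T \<subseteq> carrier L" using center_closed by blast
  have N: "submodule K (span T) L" by (rule span_is_submodule[OF TL])
  interpret N: submodule K "span T" L by (rule N)
  have T_span: "T \<subseteq> span T" by (rule in_own_span[OF TL])
  have zN: "r \<odot> z \<in> span T" if "r \<in> carrier K" for r
    using that T_span by (intro N.smult_closed) (auto simp: T_def)
  have R_span: "e_bracket (i', j') \<in> span T"
    if "i' < j'" "j' < d" "(i', j') \<notin> {(i, j), (a, b), (0, a), (0, b)}" for i' j'
    using that T_span by (auto simp: T_def R_def increasing_pairs_def)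
  \<comment> \<open>The relation \<open>w\<close> has no term at the three other removed pairs, so it eliminates the bracket at \<open>(i, j)\<close>.\<close>
  have cij: "e_bracket (i, j) \<in> span T"
  proof (rule pair_sum_pivot_in_submodule[OF N w])
    show "pair_sum w \<in> span T" using rel zN by auto
    show "w i' j' = \<zero>\<^bsub>K\<^esub> \<or> e_bracket (i', j') \<in> span T"
      if "i' < j'" "j' < d" "(i', j') \<noteq> (i, j)" for i' j'
      using that w0 R_span by fastforce
  qed (use ij nz in auto)
  note tD = alternating_arrayD[OF t]
  have t_closed: "t i' j' k \<in> carrier K" for i' j' k by (rule tD(1))
  have diag: "t i' j' i' = \<zero>\<^bsub>K\<^esub>" "t i' j' j' = \<zero>\<^bsub>K\<^esub>" for i' j'
    using tD(2,4) by metis+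
  have row_in: "pair_sum (\<lambda>i j. t i j k) \<in> span T" if "k < d" for k
    using rows[OF that] zN by auto
  \<comment> \<open>Contracting with an index kills every pair that contains it; of the three special pairs only one survives.\<close>
  have c0b: "e_bracket (0, b) \<in> span T"
  proof (rule pair_sum_pivot_in_submodule[OF N, where w = "\<lambda>i j. t i j a"])
    have "t 0 b a = \<ominus>\<^bsub>K\<^esub> t a b 0" using tD(3,4) by metis
    then show "t 0 b a \<noteq> \<zero>\<^bsub>K\<^esub>" using ab(4) t_closed by (metis R.minus_minus R.minus_zero)
    show "t i' j' a = \<zero>\<^bsub>K\<^esub> \<or> e_bracket (i', j') \<in> span T"
      if "i' < j'" "j' < d" "(i', j') \<noteq> (0, b)" for i' j'
    proof (cases "(i', j') \<in> {(i, j), (a, b), (0, a), (0, b)}")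
      case True
      then show ?thesis using that diag cij by auto
    qed (use that R_span in blast)
  qed (use ab row_in t_closed in auto)
  have c0a: "e_bracket (0, a) \<in> span T"
  proof (rule pair_sum_pivot_in_submodule[OF N, where w = "\<lambda>i j. t i j b"])
    have "t 0 a b = t a b 0" by (rule tD(4))
    then show "t 0 a b \<noteq> \<zero>\<^bsub>K\<^esub>" using ab(4) by simp
    show "t i' j' b = \<zero>\<^bsub>K\<^esub> \<or> e_bracket (i', j') \<in> span T"
      if "i' < j'" "j' < d" "(i', j') \<noteq> (0, a)" for i' j'
    proof (cases "(i', j') \<in> {(i, j), (a, b), (0, a), (0, b)}")
      case True
      then show ?thesis using that diag cij by auto
    qed (use that R_span in blast)
  qed (use ab row_in t_closed in auto)
  have cab: "e_bracket (a, b) \<in> span T"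
  proof (rule pair_sum_pivot_in_submodule[OF N, where w = "\<lambda>i j. t i j 0"])
    show "t i' j' 0 = \<zero>\<^bsub>K\<^esub> \<or> e_bracket (i', j') \<in> span T"
      if "i' < j'" "j' < d" "(i', j') \<noteq> (a, b)" for i' j'
    proof (cases "(i', j') \<in> {(i, j), (a, b), (0, a), (0, b)}")
      case True
      then show ?thesis using that diag cij by auto
    qed (use that R_span in blast)
  qed (use ab row_in t_closed in auto)
  have "e_bracket p \<in> span T" if "p \<in> P" for p
  proof (cases "p \<in> R")
    case True
    then show ?thesis using T_span by (auto simp: T_def)
  next
    case False
    then show ?thesis using that cij c0b c0a cab by (auto simp: R_def)
  qed
  then have "vectorspace.dim K (L\<lparr>carrier := lie_center L\<rparr>) \<le> card T"
    by (rule dim_center_le_card[OF T])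
  also have "card T \<le> Suc (card (e_bracket ` R))"
    by (simp add: T_def R_def card_insert_if)
  also have "card (e_bracket ` R) \<le> card R" by (rule card_image_le) (simp add: R_def)
  finally have "vectorspace.dim K (L\<lparr>carrier := lie_center L\<rparr>) \<le> Suc (card R)" by simp
  moreover have "card R + 4 = card P"
  proof -
    have "(i, j) \<notin> {(a, b), (0, a), (0, b)}" using nz w0 by auto
    then have "card {(i, j), (a, b), (0, a), (0, b)} = 4" using ab by simp
    moreover have "{(i, j), (a, b), (0, a), (0, b)} \<subseteq> P"
      using ij ab by (auto simp: increasing_pairs_def)
    ultimately show ?thesis
      unfolding R_def by (metis card_Diff_subset card_mono finite_increasing_pairs finite_subset le_add_diff_inverse2)
  qed
  ultimately show False using card by linarith
qed

text \<open>The hypothesis says that \<open>z \<otimes> e 0\<close> and \<open>z \<otimes> e 1\<close> come from alternating arrays \<open>t\<close> and \<open>t1\<close>. If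
  \<open>t a b 0\<close> is nonzero, subtract from \<open>t1\<close> the multiple of \<open>t\<close> that removes the entry \<open>(a, b, 0)\<close>.
  The contractions of the difference at \<open>0\<close>, \<open>a\<close> and \<open>b\<close> then vanish on the three determining
  coordinates, hence vanish; by alternation so do those coordinates in every other contraction. So
  the difference is zero, while its contraction at \<open>1\<close> still maps to \<open>z\<close>.\<close>

lemma delta_sequences_zero:
  assumes card: "card P \<le> vectorspace.dim K (L\<lparr>carrier := lie_center L\<rparr>) + 2"
    and d: "2 \<le> d"
    and z: "z \<in> lie_center L"
    and s: "\<And>l k. \<lbrakk>l < 2; k < d\<rbrakk> \<Longrightarrow> s l k = (if k = l then z else \<zero>)"
    and rel: "\<And>l. l < 2 \<Longrightarrow> s l \<in> jacobi_relations"
  shows "z = \<zero>"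
proof -
  have zL: "z \<in> carrier L" using z by (rule center_closed)
  have cr: "cring K" ..
  obtain t where t: "alternating_array K t" "s 0 = (\<lambda>k. pair_sum (\<lambda>i j. t i j k))"
    using rel[of 0] by (auto simp: jacobi_relations_def)
  obtain t1 where t1: "alternating_array K t1" "s 1 = (\<lambda>k. pair_sum (\<lambda>i j. t1 i j k))"
    using rel[of 1] by (auto simp: jacobi_relations_def)
  note tD = alternating_arrayD[OF t(1)] and t1D = alternating_arrayD[OF t1(1)]
  have t_row: "pair_sum (\<lambda>i j. t i j k) = (if k = 0 then z else \<zero>)" if "k < d" for k
    using s[of 0 k] that t(2) by simp
  have t1_row: "pair_sum (\<lambda>i j. t1 i j k) = (if k = 1 then z else \<zero>)" if "k < d" for k
    using s[of 1 k] that t1(2) by simp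
  show ?thesis
  proof (cases "\<forall>i j. i < j \<and> j < d \<longrightarrow> t i j 0 = \<zero>\<^bsub>K\<^esub>")
    case True
    then have "pair_sum (\<lambda>i j. t i j 0) = pair_sum (\<lambda>i j. \<zero>\<^bsub>K\<^esub>)"
      by (intro pair_sum_cong) auto
    then show ?thesis using t_row[of 0] d by (simp add: pair_sum_zero)
  next
    case False
    then obtain a b where ab: "a < b" "b < d" "t a b 0 \<noteq> \<zero>\<^bsub>K\<^esub>" by blast
    have "t 0 b 0 = \<zero>\<^bsub>K\<^esub>" using tD(2,4) by metis
    \<comment> \<open>An alternating array vanishes at \<open>(0, b, 0)\<close>.\<close>
    then have a: "0 < a" using ab by (cases a) auto
    have rows: "\<exists>r\<in>carrier K. pair_sum (\<lambda>i j. t i j k) = r \<odot> z" if "k < d" for k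
      using t_row[OF that] zL by (cases "k = 0") (auto intro: bexI[of _ "\<one>\<^bsub>K\<^esub>"] bexI[of _ "\<zero>\<^bsub>K\<^esub>"])
    define r where "r = \<ominus>\<^bsub>K\<^esub> (t1 a b 0 \<otimes>\<^bsub>K\<^esub> inv\<^bsub>K\<^esub> (t a b 0))"
    have unit: "t a b 0 \<in> Units K" using ab tD(1) by (simp add: field_Units)
    have r: "r \<in> carrier K" using unit t1D(1) by (simp add: r_def)
    define u where "u i j k = t1 i j k \<oplus>\<^bsub>K\<^esub> r \<otimes>\<^bsub>K\<^esub> t i j k" for i j k
    have u: "alternating_array K u"
      unfolding u_def by (intro alternating_array_add alternating_array_smult cr r t t1)
    note uD = alternating_arrayD[OF u]
    have u_closed: "u i j k \<in> carrier K" for i j k by (rule uD(1))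
    have uab: "u a b 0 = \<zero>\<^bsub>K\<^esub>"
      using unit t1D(1) tD(1) by (simp add: u_def r_def R.l_minus R.m_assoc R.r_neg)
    have u_row: "pair_sum (\<lambda>i j. u i j k)
        = (if k = 1 then z else \<zero>) \<oplus> r \<odot> (if k = 0 then z else \<zero>)" if "k < d" for k
      unfolding u_def using that r tD(1) t1D(1)
      by (simp add: pair_sum_add pair_sum_smult t_row t1_row del: if_split)
    have u_rows: "\<exists>q\<in>carrier K. pair_sum (\<lambda>i j. u i j k) = q \<odot> z" if "k < d" for k
    proof (intro bexI)
      show "pair_sum (\<lambda>i j. u i j k) = (if k = 1 then \<one>\<^bsub>K\<^esub> else if k = 0 then r else \<zero>\<^bsub>K\<^esub>) \<odot> z"
        using u_row[OF that] zL r by auto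
    qed (use r in auto)
    have vanish: "u i j k = \<zero>\<^bsub>K\<^esub>"
      if k: "k < d" and u0: "u a b k = \<zero>\<^bsub>K\<^esub>" "u 0 a k = \<zero>\<^bsub>K\<^esub>" "u 0 b k = \<zero>\<^bsub>K\<^esub>"
        and ij: "i < d" "j < d" for i j k
    proof -
      have less: "u i' j' k = \<zero>\<^bsub>K\<^esub>" if "i' < j'" "j' < d" for i' j'
        by (rule relation_vanishes[OF card z t(1) rows a ab u_closed u_rows[OF k] u0 that])
      consider "i < j" | "i = j" | "j < i" by linarith
      then show ?thesis
      proof cases
        case 3
        then have "u i j k = \<ominus>\<^bsub>K\<^esub> \<zero>\<^bsub>K\<^esub>" using less[of j i] ij uD(3)[of i j k] by simp
        then show ?thesis by simp
      qed (use less ij uD(2) in auto)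
    qed
    have diag: "u i j i = \<zero>\<^bsub>K\<^esub>" "u i j j = \<zero>\<^bsub>K\<^esub>" for i j
      using uD(2,4) by metis+
    have u0ab: "u 0 a b = \<zero>\<^bsub>K\<^esub>" using uD(4)[of 0 a b] uab by simp
    have "u b 0 a = \<zero>\<^bsub>K\<^esub>" using uD(4)[of a b 0] uab by simp
    then have u0ba: "u 0 b a = \<zero>\<^bsub>K\<^esub>" using uD(3)[of 0 b a] by simp
    have row: "u i j k = \<zero>\<^bsub>K\<^esub>" if "k \<in> {0, a, b}" "i < d" "j < d" for i j k
      by (rule vanish) (use that ab a uab u0ab u0ba diag in auto)
    have last: "u i j 1 = \<zero>\<^bsub>K\<^esub>" if "i < d" "j < d" for i j
    proof (rule vanish)
      show "u a b 1 = \<zero>\<^bsub>K\<^esub>" using uD(4)[of a b 1] row[of a b 1] ab d by simp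
      show "u 0 a 1 = \<zero>\<^bsub>K\<^esub>" using uD(4)[of 0 a 1] row[of 0 a 1] ab d by simp
      show "u 0 b 1 = \<zero>\<^bsub>K\<^esub>" using uD(4)[of 0 b 1] row[of 0 b 1] ab d by simp
    qed (use that d in auto)
    have "pair_sum (\<lambda>i j. u i j 1) = pair_sum (\<lambda>i j. \<zero>\<^bsub>K\<^esub>)"
      using last by (intro pair_sum_cong) auto
    then show ?thesis using u_row[of 1] d zL r by (simp add: pair_sum_zero)
  qed
qed

section \<open>Capability of Heisenberg algebras with few relations\<close>

text \<open>The alternating extension to \<open>L\<close> of the pairing \<open>(z, x) \<mapsto> z \<otimes> x\<close> between the center and
  \<open>L/Z(L)\<close>, set to zero on pairs from the span of the \<open>e j\<close>.\<close>

definition mixed_product :: "'c \<Rightarrow> 'c \<Rightarrow> nat \<Rightarrow> 'c" where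
  "mixed_product x y = (\<lambda>k. \<kappa> k y \<odot> \<zeta> x \<oplus> \<ominus> (\<kappa> k x \<odot> \<zeta> y))"

text \<open>On a bracket and an element of \<open>L\<close> the mixed product is their tensor product up to sign, so its
  cyclic sums lie in the Jacobi relations and it induces a cocycle with values in the quotient. If
  that cocycle kills a central \<open>z\<close>, then all \<open>z \<otimes> e l\<close> are Jacobi relations; two of them force
  \<open>z\<close> to be zero.\<close>

lemma capable_if_few_relations:
  assumes card: "card P \<le> vectorspace.dim K (L\<lparr>carrier := lie_center L\<rparr>) + 2"
    and d: "2 \<le> d"
  shows "capable K L"
proof -
  let ?M = "sequence_space L" and ?S = jacobi_relations
  interpret S: lie_ideal K ?M ?S
    by (rule sequence_space_lie_ideal[OF lie_algebra_axioms jacobi_relations_submodule])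
  interpret Q: lie_algebra K "lie_quotient ?M ?S" by (rule S.quotient_lie_algebra)
  define \<phi> where "\<phi> x y = ?S +>\<^bsub>?M\<^esub> mixed_product x y" for x y
  have closed: "mixed_product x y \<in> carrier ?M" if "x \<in> carrier L" "y \<in> carrier L" for x y
    using that by (simp add: mixed_product_def sequence_space_simps)
  have in_S: "?S +>\<^bsub>?M\<^esub> s = \<zero>\<^bsub>lie_quotient ?M ?S\<^esub> \<longleftrightarrow> s \<in> ?S" if "s \<in> carrier ?M" for s
    using that by (simp add: S.quotient_zero S.coset_eq_iff S.M.add.inv_one[simplified] a_inv_def)
  have mixed_center: "mixed_product x w k = \<kappa> k x \<odot> \<ominus> w"
    if "x \<in> carrier L" "w \<in> lie_center L" for x w k
    using that by (simp add: mixed_product_def \<kappa>_center \<zeta>_center center_closed smult_r_minus)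
  show ?thesis
  proof (rule capable_by_cocycle[where \<phi> = \<phi> and M = "lie_quotient ?M ?S"])
    show "lie_algebra K L" ..
    show "vectorspace K (lie_quotient ?M ?S)" ..
  next
    fix x y assume xy: "x \<in> carrier L" "y \<in> carrier L"
    show "\<phi> x y \<in> carrier (lie_quotient ?M ?S)"
      using closed[OF xy] by (simp add: \<phi>_def S.quotient_carrier)
    have "mixed_product x x = \<zero>\<^bsub>?M\<^esub>"
      using xy by (simp add: mixed_product_def sequence_space_simps M.r_neg)
    then show "\<phi> x x = \<zero>\<^bsub>lie_quotient ?M ?S\<^esub>" by (simp add: \<phi>_def S.quotient_zero)
  next
    fix x y z assume xyz: "x \<in> carrier L" "y \<in> carrier L" "z \<in> carrier L"
    have "mixed_product (x \<oplus> y) z = mixed_product x z \<oplus>\<^bsub>?M\<^esub> mixed_product y z"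
      using xyz by (simp add: mixed_product_def sequence_space_simps fun_eq_iff \<kappa>_add \<zeta>_add
          smult_r_distr smult_l_distr M.minus_add M.a_assoc M.a_lcomm)
    then show "\<phi> (x \<oplus> y) z = \<phi> x z \<oplus>\<^bsub>lie_quotient ?M ?S\<^esub> \<phi> y z"
      using xyz closed by (simp add: \<phi>_def S.quotient_add)
    have "mixed_product x (y \<oplus> z) = mixed_product x y \<oplus>\<^bsub>?M\<^esub> mixed_product x z"
      using xyz by (simp add: mixed_product_def sequence_space_simps fun_eq_iff \<kappa>_add \<zeta>_add
          smult_r_distr smult_l_distr M.minus_add M.a_assoc M.a_lcomm)
    then show "\<phi> x (y \<oplus> z) = \<phi> x y \<oplus>\<^bsub>lie_quotient ?M ?S\<^esub> \<phi> x z"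
      using xyz closed by (simp add: \<phi>_def S.quotient_add)
    \<comment> \<open>The sign from the central second argument is absorbed by reversing each bracket.\<close>
    have "mixed_product x \<lbrakk>y, z\<rbrakk> \<oplus>\<^bsub>?M\<^esub> mixed_product y \<lbrakk>z, x\<rbrakk> \<oplus>\<^bsub>?M\<^esub> mixed_product z \<lbrakk>x, y\<rbrakk>
        = (\<lambda>k. \<kappa> k x \<odot> \<lbrakk>z, y\<rbrakk> \<oplus> \<kappa> k z \<odot> \<lbrakk>y, x\<rbrakk> \<oplus> \<kappa> k y \<odot> \<lbrakk>x, z\<rbrakk>)"
      using xyz by (simp add: sequence_space_simps fun_eq_iff mixed_center bracket_in_center
          bracket_swap[OF xyz(2,3), symmetric] bracket_swap[OF xyz(3,1), symmetric]
          bracket_swap[OF xyz(1,2), symmetric] M.a_assoc M.a_comm M.a_lcomm)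
    then have "mixed_product x \<lbrakk>y, z\<rbrakk> \<oplus>\<^bsub>?M\<^esub> mixed_product y \<lbrakk>z, x\<rbrakk> \<oplus>\<^bsub>?M\<^esub> mixed_product z \<lbrakk>x, y\<rbrakk> \<in> ?S"
      using jacobi_in_relations[of x z y] xyz by simp
    then show "\<phi> x \<lbrakk>y, z\<rbrakk> \<oplus>\<^bsub>lie_quotient ?M ?S\<^esub> \<phi> y \<lbrakk>z, x\<rbrakk> \<oplus>\<^bsub>lie_quotient ?M ?S\<^esub> \<phi> z \<lbrakk>x, y\<rbrakk>
        = \<zero>\<^bsub>lie_quotient ?M ?S\<^esub>"
      using xyz closed by (simp add: \<phi>_def S.quotient_add in_S)
  next
    fix r x y assume rxy: "r \<in> carrier K" "x \<in> carrier L" "y \<in> carrier L"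
    have "mixed_product (r \<odot> x) y = r \<odot>\<^bsub>?M\<^esub> mixed_product x y"
      and "mixed_product x (r \<odot> y) = r \<odot>\<^bsub>?M\<^esub> mixed_product x y"
      using rxy by (simp_all add: mixed_product_def sequence_space_simps fun_eq_iff \<kappa>_smult \<zeta>_smult
          smult_r_distr smult_r_minus smult_assoc1[symmetric] R.m_comm)
    then show "\<phi> (r \<odot> x) y = r \<odot>\<^bsub>lie_quotient ?M ?S\<^esub> \<phi> x y"
      and "\<phi> x (r \<odot> y) = r \<odot>\<^bsub>lie_quotient ?M ?S\<^esub> \<phi> x y"
      using rxy closed by (simp_all add: \<phi>_def S.quotient_smult)
  next
    fix z assume z: "z \<in> lie_center L"
      and 0: "\<And>y. y \<in> carrier L \<Longrightarrow> \<phi> z y = \<zero>\<^bsub>lie_quotient ?M ?S\<^esub>"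
    show "z = \<zero>"
    proof (rule delta_sequences_zero[OF card d z])
      show "mixed_product z (e l) k = (if k = l then z else \<zero>)" if "l < 2" "k < d" for l k
        using that z d by (simp add: mixed_product_def \<kappa>_e \<kappa>_center \<zeta>_center center_closed)
      show "mixed_product z (e l) \<in> ?S" for l
        using 0[of "e l"] z closed in_S by (simp add: \<phi>_def center_closed)
    qed
  qed
qed

end

theorem theorem2p4:
  fixes K :: "('k, 'm) ring_scheme"
    and L :: "('k, 'v, 'n) lie_alg_scheme"
    and d n :: nat
  assumes "generalized_heisenberg K L n"
    and "d_generator K L d"
    and "real n = real d * (real d - 1) / 2 - 1 \<or> real n = real d * (real d - 1) / 2 - 2"
  shows "capable K L"
proof -
  interpret lie_algebra K L using assms(1) by (simp add: generalized_heisenberg_def)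
  have derived: "lie_derived K L = lie_center L"
    and dim: "vectorspace.dim K (L\<lparr>carrier := lie_center L\<rparr>) = n"
    using assms(1) by (auto simp: generalized_heisenberg_def)
  interpret Z: lie_ideal K L "lie_center L" by (rule center_lie_ideal)
  obtain e \<kappa> where "heisenberg_coordinates K L d e \<kappa>"
  proof (rule Z.coordinates_modulo_ideal[of d])
    show "vectorspace.fin_dim K (lie_quotient L (lie_center L))"
      and "vectorspace.dim K (lie_quotient L (lie_center L)) = d"
      using assms(2) by (simp_all add: d_generator_def derived)
  next
    fix e \<kappa>
    assume *: "\<And>j. e j \<in> carrier L"
      "\<And>j x. x \<in> carrier L \<Longrightarrow> \<kappa> j x \<in> carrier K"
      "\<And>j x y. \<lbrakk>x \<in> carrier L; y \<in> carrier L\<rbrakk> \<Longrightarrow> \<kappa> j (x \<oplus>\<^bsub>L\<^esub> y) = \<kappa> j x \<oplus>\<^bsub>K\<^esub> \<kappa> j y"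
      "\<And>j r x. \<lbrakk>r \<in> carrier K; x \<in> carrier L\<rbrakk> \<Longrightarrow> \<kappa> j (r \<odot>\<^bsub>L\<^esub> x) = r \<otimes>\<^bsub>K\<^esub> \<kappa> j x"
      "\<And>i j. \<lbrakk>i < d; j < d\<rbrakk> \<Longrightarrow> \<kappa> i (e j) = (if i = j then \<one>\<^bsub>K\<^esub> else \<zero>\<^bsub>K\<^esub>)"
      "\<And>j x. x \<in> lie_center L \<Longrightarrow> \<kappa> j x = \<zero>\<^bsub>K\<^esub>"
      "\<And>x. \<lbrakk>x \<in> carrier L; \<And>j. j < d \<Longrightarrow> \<kappa> j x = \<zero>\<^bsub>K\<^esub>\<rbrakk> \<Longrightarrow> x \<in> lie_center L"
    show thesis
    proof (rule that[of e \<kappa>], unfold_locales)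
      fix x assume "x \<in> carrier L" "\<And>j. j < d \<Longrightarrow> \<kappa> j x = \<zero>\<^bsub>K\<^esub>"
      then show "x \<in> lie_center L" by (rule *(7))
    qed (simp_all add: *(1-6) derived)
  qed
  then interpret heisenberg_coordinates K L d e \<kappa> .
  \<comment> \<open>For smaller \<open>d\<close> the rank would be negative.\<close>
  have d: "2 \<le> d"
  proof (rule ccontr)
    assume "\<not> 2 \<le> d"
    then have "d = 0 \<or> d = 1" by linarith
    then show False using assms(3) by auto
  qed
  have "2 * real (card (increasing_pairs d)) = real d * (real d - 1)"
  proof -
    have "2 * real (card (increasing_pairs d)) = real (d * (d - 1))"
      unfolding card_increasing_pairs[symmetric] by simp
    then show ?thesis using d by (simp add: of_nat_diff)
  qed
  then have "card (increasing_pairs d) \<le> n + 2" using assms(3) by linarith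
  then show ?thesis using d by (intro capable_if_few_relations) (simp_all add: dim)
qed

end
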